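(* For $0\le i,j\le D$ with $i+j\ge D$ and for $0\le\eta\le D$, $$V_{ij}\cap V_\eta=\sum \tilde V_{rs},$$ where the sum is over all ordered pairs $(r,s)$ with $0\le r\le i$, $0\le s\le j$ and $r+s-D=\eta$.
   Context: Let $\Gamma=(X,R)$ be a finite connected distance-regular graph with path-length distance $\partial$ and diameter $D\ge3$, $Q$-polynomial with respect to the ordering $E_0,\dots,E_D$ of its primitive idempotents (the primitive idempotents of the Bose–Mesner algebra spanned by the distance matrices; $Q$-polynomial means the Krein parameters $q^h_{ij}$, defined by $E_i\circ E_j=|X|^{-1}\sum_hq^h_{ij}E_h$, vanish whenever one of $h,i,j$ exceeds the sum of the other two and are nonzero whenever one equals the sum of the other two). Let $A$ be the adjacency matrix, $V=\mathbb C^X$ with Hermitean inner product $\langle u,v\rangle=u^t\overline v$. Fix $x\in X$; for $0\le i\le D$ let $E^*_i$ be the diagonal matrix with $(E^*_i)_{yy}=1$ if $\partial(x,y)=i$ and $0$ otherwise; let $A^*$ be the diagonal matrix with $(A^* )_{yy}=|X|(E_1)_{xy}$, and $T$ the algebra generated by $A$ and $A^*$. A $T$-module is a $T$-invariant subspace of $V$; it is irreducible if nonzero with no $T$-submodules other than $0$ and itself. For an irreducible $T$-module $W$ with endpoint $\rho=\min\{i:E^*_iW\ne0\}$, dual endpoint $\tau=\min\{i:E_iW\ne0\}$, and diameter $d=|\{i:E^*_iW\ne0\}|-1$, its displacement is $\rho+\tau+d-D$. For $0\le\eta\le D$, $V_\eta$ is the subspace of $V$ spanned by the irreducible $T$-modules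 of displacement $\eta$. For $-1\le i,j\le D$ define $V_{ij}=(E^*_0V+\cdots+E^*_iV)\cap(E_0V+\cdots+E_jV)$ (so $V_{ij}=0$ if $i=-1$ or $j=-1$). For $0\le i,j\le D$ let $\tilde V_{ij}$ be the orthogonal complement of $V_{i,j-1}+V_{i-1,j}$ in $V_{ij}$. *)

theory Defs
  imports "HOL-Analysis.Analysis"
begin

text \<open>The vertex set X is the whole (finite) type 'a; the graph is given by an
adjacency relation adj. Vectors of V = C^X are complex^'a, matrices are complex^'a^'a.\<close>

definition gdist :: "('a \<Rightarrow> 'a \<Rightarrow> bool) \<Rightarrow> 'a \<Rightarrow> 'a \<Rightarrow> nat" where
  "gdist adj u v = (LEAST n. (adj ^^ n) u v)"

definition simple_connected_graph :: "('a::finite \<Rightarrow> 'a \<Rightarrow> bool) \<Rightarrow> bool" where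
  "simple_connected_graph adj \<longleftrightarrow>
     (\<forall>u v. adj u v \<longrightarrow> adj v u) \<and> (\<forall>u. \<not> adj u u) \<and>
     (\<forall>u v. \<exists>n. (adj ^^ n) u v)"

definition diam :: "('a::finite \<Rightarrow> 'a \<Rightarrow> bool) \<Rightarrow> nat" where
  "diam adj = Max {gdist adj u v | u v. True}"

definition distance_regular :: "('a::finite \<Rightarrow> 'a \<Rightarrow> bool) \<Rightarrow> bool" where
  "distance_regular adj \<longleftrightarrow> simple_connected_graph adj \<and>
     (\<forall>h i j u v u' v'. gdist adj u v = h \<and> gdist adj u' v' = h \<longrightarrow>
        card {z. gdist adj u z = i \<and> gdist adj v z = j} =
        card {z. gdist adj u' z = i \<and> gdist adj v' z = j})"

definition cspan :: "(complex^'n) set \<Rightarrow> (complex^'n) set" where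
  "cspan S = {v. \<exists>F c. finite F \<and> F \<subseteq> S \<and> v = (\<Sum>u\<in>F. c u *s u)}"

definition mscale :: "complex \<Rightarrow> complex^'n^'m \<Rightarrow> complex^'n^'m" where
  "mscale c M = (\<chi> i j. c * M$i$j)"

definition mspan :: "(complex^'n^'m) set \<Rightarrow> (complex^'n^'m) set" where
  "mspan S = {B. \<exists>F c. finite F \<and> F \<subseteq> S \<and> B = (\<Sum>M\<in>F. mscale (c M) M)}"

definition csubspace :: "(complex^'n) set \<Rightarrow> bool" where
  "csubspace W \<longleftrightarrow> 0 \<in> W \<and> (\<forall>u\<in>W. \<forall>v\<in>W. u + v \<in> W) \<and> (\<forall>c. \<forall>u\<in>W. c *s u \<in> W)"

definition cinner :: "complex^'n \<Rightarrow> complex^'n \<Rightarrow> complex" where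
  "cinner u v = (\<Sum>y\<in>UNIV. u$y * cnj (v$y))"

definition hadamard :: "complex^'n^'m \<Rightarrow> complex^'n^'m \<Rightarrow> complex^'n^'m" where
  "hadamard M N = (\<chi> i j. M$i$j * N$i$j)"

definition mimage :: "complex^'n^'m \<Rightarrow> (complex^'n) set \<Rightarrow> (complex^'m) set" where
  "mimage B W = (\<lambda>v. B *v v) ` W"

definition setsum :: "(complex^'n) set \<Rightarrow> (complex^'n) set \<Rightarrow> (complex^'n) set" where
  "setsum U W = {u + w | u w. u \<in> U \<and> w \<in> W}"

definition distmat :: "('a::finite \<Rightarrow> 'a \<Rightarrow> bool) \<Rightarrow> nat \<Rightarrow> complex^'a^'a" where
  "distmat adj i = (\<chi> y z. if gdist adj y z = i then 1 else 0)"

definition bose_mesner :: "('a::finite \<Rightarrow> 'a \<Rightarrow> bool) \<Rightarrow> (complex^'a^'a) set" where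
  "bose_mesner adj = mspan {distmat adj i | i. i \<le> diam adj}"

definition primitive_idempotent :: "('a::finite \<Rightarrow> 'a \<Rightarrow> bool) \<Rightarrow> complex^'a^'a \<Rightarrow> bool" where
  "primitive_idempotent adj P \<longleftrightarrow> P \<in> bose_mesner adj \<and> P ** P = P \<and> P \<noteq> 0 \<and>
     (\<forall>F \<in> bose_mesner adj. F ** F = F \<and> F ** P = F \<longrightarrow> F = 0 \<or> F = P)"

definition idempotent_ordering :: "('a::finite \<Rightarrow> 'a \<Rightarrow> bool) \<Rightarrow> (nat \<Rightarrow> complex^'a^'a) \<Rightarrow> bool" where
  "idempotent_ordering adj E \<longleftrightarrow>
     bij_betw E {0..diam adj} {P. primitive_idempotent adj P}"

text \<open>Q-polynomial: the Krein parameters q^h_{ij}, defined by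
  E_i o E_j = |X|^{-1} sum_h q^h_{ij} E_h, satisfy the triangle conditions.\<close>
definition Q_polynomial :: "('a::finite \<Rightarrow> 'a \<Rightarrow> bool) \<Rightarrow> (nat \<Rightarrow> complex^'a^'a) \<Rightarrow> bool" where
  "Q_polynomial adj E \<longleftrightarrow> idempotent_ordering adj E \<and>
     (\<exists>q :: nat \<Rightarrow> nat \<Rightarrow> nat \<Rightarrow> complex.
        (\<forall>i\<le>diam adj. \<forall>j\<le>diam adj.
           hadamard (E i) (E j) =
             mscale (1 / of_nat CARD('a)) (\<Sum>h\<le>diam adj. mscale (q h i j) (E h))) \<and>
        (\<forall>h\<le>diam adj. \<forall>i\<le>diam adj. \<forall>j\<le>diam adj.
           (h > i + j \<or> i > h + j \<or> j > h + i) \<longrightarrow> q h i j = 0) \<and>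
        (\<forall>h\<le>diam adj. \<forall>i\<le>diam adj. \<forall>j\<le>diam adj.
           (h = i + j \<or> i = h + j \<or> j = h + i) \<longrightarrow> q h i j \<noteq> 0))"

definition Estar :: "('a::finite \<Rightarrow> 'a \<Rightarrow> bool) \<Rightarrow> 'a \<Rightarrow> nat \<Rightarrow> complex^'a^'a" where
  "Estar adj x i = (\<chi> y z. if y = z \<and> gdist adj x y = i then 1 else 0)"

definition Astar :: "(nat \<Rightarrow> complex^'a^'a) \<Rightarrow> 'a::finite \<Rightarrow> complex^'a^'a" where
  "Astar E x = (\<chi> y z. if y = z then of_nat CARD('a) * E 1 $ x $ y else 0)"

inductive_set gen_alg :: "complex^'a^'a \<Rightarrow> complex^'a^'a \<Rightarrow> (complex^'a^'a) set"
  for P Q :: "complex^'a^'a" where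
  one: "mat 1 \<in> gen_alg P Q"
| gen1: "P \<in> gen_alg P Q"
| gen2: "Q \<in> gen_alg P Q"
| add: "B \<in> gen_alg P Q \<Longrightarrow> C \<in> gen_alg P Q \<Longrightarrow> B + C \<in> gen_alg P Q"
| scale: "B \<in> gen_alg P Q \<Longrightarrow> mscale c B \<in> gen_alg P Q"
| mult: "B \<in> gen_alg P Q \<Longrightarrow> C \<in> gen_alg P Q \<Longrightarrow> B ** C \<in> gen_alg P Q"

definition Talg :: "('a::finite \<Rightarrow> 'a \<Rightarrow> bool) \<Rightarrow> (nat \<Rightarrow> complex^'a^'a) \<Rightarrow> 'a \<Rightarrow> (complex^'a^'a) set" where
  "Talg adj E x = gen_alg (distmat adj 1) (Astar E x)"

definition T_module :: "('a::finite \<Rightarrow> 'a \<Rightarrow> bool) \<Rightarrow> (nat \<Rightarrow> complex^'a^'a) \<Rightarrow> 'a \<Rightarrow> (complex^'a) set \<Rightarrow> bool" where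
  "T_module adj E x W \<longleftrightarrow> csubspace W \<and> (\<forall>B \<in> Talg adj E x. \<forall>v\<in>W. B *v v \<in> W)"

definition irreducible_T_module :: "('a::finite \<Rightarrow> 'a \<Rightarrow> bool) \<Rightarrow> (nat \<Rightarrow> complex^'a^'a) \<Rightarrow> 'a \<Rightarrow> (complex^'a) set \<Rightarrow> bool" where
  "irreducible_T_module adj E x W \<longleftrightarrow> T_module adj E x W \<and> W \<noteq> {0} \<and>
     (\<forall>U. T_module adj E x U \<and> U \<subseteq> W \<longrightarrow> U = {0} \<or> U = W)"

definition endpoint :: "('a::finite \<Rightarrow> 'a \<Rightarrow> bool) \<Rightarrow> 'a \<Rightarrow> (complex^'a) set \<Rightarrow> nat" where
  "endpoint adj x W = (LEAST i. mimage (Estar adj x i) W \<noteq> {0})"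

definition dual_endpoint :: "(nat \<Rightarrow> complex^'a^'a) \<Rightarrow> (complex^'a) set \<Rightarrow> nat" where
  "dual_endpoint E W = (LEAST i. mimage (E i) W \<noteq> {0})"

definition module_diameter :: "('a::finite \<Rightarrow> 'a \<Rightarrow> bool) \<Rightarrow> 'a \<Rightarrow> (complex^'a) set \<Rightarrow> nat" where
  "module_diameter adj x W = card {i. i \<le> diam adj \<and> mimage (Estar adj x i) W \<noteq> {0}} - 1"

definition displacement :: "('a::finite \<Rightarrow> 'a \<Rightarrow> bool) \<Rightarrow> (nat \<Rightarrow> complex^'a^'a) \<Rightarrow> 'a \<Rightarrow> (complex^'a) set \<Rightarrow> int" where
  "displacement adj E x W = int (endpoint adj x W) + int (dual_endpoint E W)
      + int (module_diameter adj x W) - int (diam adj)"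

definition Veta :: "('a::finite \<Rightarrow> 'a \<Rightarrow> bool) \<Rightarrow> (nat \<Rightarrow> complex^'a^'a) \<Rightarrow> 'a \<Rightarrow> nat \<Rightarrow> (complex^'a) set" where
  "Veta adj E x \<eta> = cspan (\<Union> {W. irreducible_T_module adj E x W \<and> displacement adj E x W = int \<eta>})"

text \<open>V_{ij} for -1 <= i,j <= D (indices as integers; V_{ij} = 0 if i = -1 or j = -1).\<close>
definition Vij :: "('a::finite \<Rightarrow> 'a \<Rightarrow> bool) \<Rightarrow> (nat \<Rightarrow> complex^'a^'a) \<Rightarrow> 'a \<Rightarrow> int \<Rightarrow> int \<Rightarrow> (complex^'a) set" where
  "Vij adj E x i j = (if i < 0 \<or> j < 0 then {0} else
     cspan (\<Union>h\<in>{0..nat i}. mimage (Estar adj x h) UNIV) \<inter>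
     cspan (\<Union>h\<in>{0..nat j}. mimage (E h) UNIV))"

definition Vtilde :: "('a::finite \<Rightarrow> 'a \<Rightarrow> bool) \<Rightarrow> (nat \<Rightarrow> complex^'a^'a) \<Rightarrow> 'a \<Rightarrow> nat \<Rightarrow> nat \<Rightarrow> (complex^'a) set" where
  "Vtilde adj E x i j = {v \<in> Vij adj E x (int i) (int j).
     \<forall>u \<in> setsum (Vij adj E x (int i) (int j - 1)) (Vij adj E x (int i - 1) (int j)).
        cinner u v = 0}"

end

theory Submission
  imports Defs
begin

text \<open>
  On an irreducible module \<open>W\<close> with endpoint \<open>\<rho>\<close>, dual endpoint \<open>\<tau>\<close> and diameter \<open>d\<close>, the sum over
  \<open>a + b = c\<close> of the spaces \<open>V\<^sub>a\<^sub>b \<inter> W\<close> is invariant under \<open>A\<close> and \<open>A\<^sup>*\<close>, because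
  \<open>A - \<theta>\<^sub>b\<close> maps \<open>V\<^sub>a\<^sub>b\<close> into \<open>V\<close> with indices \<open>a + 1, b - 1\<close> and \<open>A\<^sup>* - \<theta>\<^sup>*\<^sub>a\<close> maps it into \<open>V\<close> with
  indices \<open>a - 1, b + 1\<close>. By irreducibility it is \<open>0\<close> or \<open>W\<close>; it is \<open>0\<close> for \<open>c < \<rho> + \<tau> + d\<close> and \<open>W\<close> for
  \<open>c = \<rho> + \<tau> + d\<close>. Hence \<open>V\<^sub>i\<^sub>j \<inter> W\<close> is the sum of those \<open>V\<^sub>r\<^sub>s \<inter> W\<close> with \<open>r \<le> i\<close>, \<open>s \<le> j\<close> and
  \<open>r + s = \<rho> + \<tau> + d\<close>. Decomposing \<open>V\<close> into an orthogonal sum of irreducible modules and noting that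
  irreducible modules of different displacement are orthogonal, the claim can be read off componentwise.

  No spectral theory is needed for the Bose-Mesner algebra: its \<open>D + 1\<close> primitive idempotents are
  mutually orthogonal, so they are linearly independent, and they form a basis by dimension.
\<close>

section \<open>The Hermitean inner product\<close>

lemma csubspace_eq: "csubspace = vec.subspace"
  by (auto simp: fun_eq_iff csubspace_def vec.subspace_def)

lemma cspan_eq: "cspan = vec.span"
  by (auto simp: fun_eq_iff cspan_def vec.span_explicit)

lemma cinner_add_left: "cinner (u + v) w = cinner u w + cinner v w"
  and cinner_add_right: "cinner w (u + v) = cinner w u + cinner w v"
  and cinner_scale_left: "cinner (c *s u) w = c * cinner u w"
  and cinner_scale_right: "cinner w (c *s u) = cnj c * cinner w u"
  and cinner_zero_left [simp]: "cinner 0 w = 0"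
  and cinner_zero_right [simp]: "cinner w 0 = 0"
  by (simp_all add: cinner_def sum.distrib sum_distrib_left algebra_simps)

lemma cinner_commute: "cinner v u = cnj (cinner u v)"
  by (simp add: cinner_def mult.commute)

lemma cinner_sum_right: "cinner w (\<Sum>i\<in>I. f i) = (\<Sum>i\<in>I. cinner w (f i))"
  by (induction I rule: infinite_finite_induct) (simp_all add: cinner_add_right)

lemma Re_cinner: "Re (cinner u v) = inner u v"
  by (simp add: cinner_def inner_vec_def inner_complex_def)

lemma cinner_self_eq_0 [simp]: "cinner u u = 0 \<longleftrightarrow> u = 0"
  by (metis Re_cinner cinner_zero_left inner_eq_zero_iff zero_complex.simps(1))

lemma subspace_orthogonal_to: "vec.subspace {v. \<forall>u\<in>U. cinner u v = 0}"
  by (auto simp: vec.subspace_def cinner_add_right cinner_scale_right)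

lemma cinner_span_left_eq_0:
  assumes "u \<in> vec.span S" "\<And>w. w \<in> S \<Longrightarrow> cinner w v = 0"
  shows "cinner u v = 0"
  using assms by (induction rule: vec.span_induct_alt) (simp_all add: cinner_add_left cinner_scale_left)

text \<open>The real inner product is the real part of \<open>cinner\<close>, so real orthogonal
  projection onto \<open>W\<close> makes \<open>Re (cinner u z)\<close> vanish for \<open>u\<close>
  in \<open>W\<close>. Applying this to \<open>\<i> *s u\<close>, which again lies in the complex
  subspace \<open>W\<close>, removes the imaginary part.\<close>

lemma complex_orthogonal_decomp:
  fixes W :: "(complex^'n) set"
  assumes W: "vec.subspace W"
  obtains w z where "w \<in> W" "\<And>u. u \<in> W \<Longrightarrow> cinner u z = 0" "v = w + z"
proof -
  have scaleR: "r *\<^sub>R u = complex_of_real r *s u" for r and u :: "complex^'n"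
    unfolding vec_eq_iff vector_scaleR_component vector_smult_component by (simp add: scaleR_conv_of_real)
  have sW: "subspace W"
    using W by (auto simp: subspace_def vec.subspace_def scaleR)
  obtain w z where wz: "w \<in> span W" "\<And>u. u \<in> span W \<Longrightarrow> orthogonal z u" "v = w + z"
    using orthogonal_subspace_decomp_exists[of W v] by metis
  have sp: "span W = W" using sW by simp
  have re: "Re (cinner u z) = 0" if "u \<in> W" for u
    using wz(2) that sp by (simp add: Re_cinner orthogonal_def inner_commute)
  have "cinner u z = 0" if u: "u \<in> W" for u
  proof -
    have "\<i> *s u \<in> W" using W u by (simp add: vec.subspace_def)
    from re[OF this] have "Im (cinner u z) = 0" by (simp add: cinner_scale_left)
    with re[OF u] show ?thesis by (simp add: complex_eq_iff)
  qed
  with wz sp show ?thesis using that by blast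
qed

lemma span_UN_subspaces:
  fixes U :: "'i \<Rightarrow> (complex^'n) set"
  assumes "finite I" "\<And>i. i \<in> I \<Longrightarrow> vec.subspace (U i)" "v \<in> vec.span (\<Union>i\<in>I. U i)"
  obtains w where "\<And>i. i \<in> I \<Longrightarrow> w i \<in> U i" "v = (\<Sum>i\<in>I. w i)"
proof -
  have "\<exists>w. (\<forall>i\<in>I. w i \<in> U i) \<and> v = (\<Sum>i\<in>I. w i)"
    using assms
  proof (induction I arbitrary: v rule: finite_induct)
    case empty
    then show ?case by simp
  next
    case (insert k I)
    from insert.prems(2) obtain a b where
      ab: "v = a + b" "a \<in> vec.span (U k)" "b \<in> vec.span (\<Union>i\<in>I. U i)"
      by (auto simp: vec.span_Un)
    from insert.IH[OF _ ab(3)] insert.prems(1)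
    obtain w where w: "\<forall>i\<in>I. w i \<in> U i" "b = (\<Sum>i\<in>I. w i)" by auto
    have "a \<in> U k" using ab(2) insert.prems(1)[of k] vec.span_minimal[of "U k" "U k"] by auto
    moreover have "(\<Sum>i\<in>I. (w(k := a)) i) = b"
      using w(2) insert.hyps(2) by (auto intro: sum.cong)
    ultimately have "(\<forall>i\<in>insert k I. (w(k := a)) i \<in> U i) \<and> v = (\<Sum>i\<in>insert k I. (w(k := a)) i)"
      using w insert.hyps ab(1) by auto
    then show ?case by blast
  qed
  then show ?thesis using that by blast
qed

definition perp :: "(complex^'n) set \<Rightarrow> (complex^'n) set" where
  "perp U = {v. \<forall>u\<in>U. cinner u v = 0}"

lemma perp_sym: "W \<subseteq> perp W' \<Longrightarrow> W' \<subseteq> perp W"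
  unfolding perp_def
proof (intro subsetI CollectI ballI)
  fix v u assume "W \<subseteq> {v. \<forall>u\<in>W'. cinner u v = 0}" "v \<in> W'" "u \<in> W"
  then have "cinner v u = 0" by auto
  then show "cinner u v = 0" by (subst cinner_commute) simp
qed

text \<open>Since both spaces contain \<open>0\<close>, each of them lies in the sum. This splits
  the orthogonality condition in \<open>Vtilde\<close> into two.\<close>

lemma perp_setsum_iff:
  assumes "0 \<in> U" "0 \<in> W"
  shows "(\<forall>u\<in>setsum U W. cinner u v = 0) \<longleftrightarrow> v \<in> perp U \<and> v \<in> perp W"
proof
  assume *: "\<forall>u\<in>setsum U W. cinner u v = 0"
  have "u \<in> setsum U W" if "u \<in> U \<or> u \<in> W" for u
    using that assms unfolding setsum_def by (metis (mono_tags, lifting) add.left_neutral add.right_neutral mem_Collect_eq)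
  with * show "v \<in> perp U \<and> v \<in> perp W" by (simp add: perp_def)
qed (auto simp: setsum_def perp_def cinner_add_left)

section \<open>Two systems of idempotents acting tridiagonally on each other\<close>

text \<open>
  \<open>B\<close> and \<open>F i\<close> stand for \<open>A\<^sup>*\<close> and \<open>E\<^sup>*\<^sub>i\<close>. The assumptions are invariant under exchanging
  \<open>(A, E, \<theta>)\<close> with \<open>(B, F, \<phi>)\<close>. The matrices \<open>E i\<close> and \<open>F i\<close> are unspecified for \<open>i > D\<close>.
\<close>
locale dual_idempotent_systems =
  fixes A B :: "complex^'n^'n" and E F :: "nat \<Rightarrow> complex^'n^'n"
    and \<theta> \<phi> :: "nat \<Rightarrow> complex" and D :: nat
  assumes E_mult: "\<lbrakk>i \<le> D; j \<le> D\<rbrakk> \<Longrightarrow> E i *v (E j *v v) = (if i = j then E i *v v else 0)"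
    and F_mult: "\<lbrakk>i \<le> D; j \<le> D\<rbrakk> \<Longrightarrow> F i *v (F j *v v) = (if i = j then F i *v v else 0)"
    and E_sum: "(\<Sum>i\<le>D. E i *v v) = v"
    and F_sum: "(\<Sum>i\<le>D. F i *v v) = v"
    and E_A: "i \<le> D \<Longrightarrow> E i *v (A *v v) = \<theta> i *s (E i *v v)"
    and F_B: "i \<le> D \<Longrightarrow> F i *v (B *v v) = \<phi> i *s (F i *v v)"
    and F_A_F: "\<lbrakk>i \<le> D; j \<le> D; Suc i < j \<or> Suc j < i\<rbrakk> \<Longrightarrow> F i *v (A *v (F j *v v)) = 0"
    and E_B_E: "\<lbrakk>i \<le> D; j \<le> D; Suc i < j \<or> Suc j < i\<rbrakk> \<Longrightarrow> E i *v (B *v (E j *v v)) = 0"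
    and E_adjoint: "i \<le> D \<Longrightarrow> cinner (E i *v u) v = cinner u (E i *v v)"
    and F_adjoint: "i \<le> D \<Longrightarrow> cinner (F i *v u) v = cinner u (F i *v v)"
    and A_adjoint: "cinner (A *v u) v = cinner u (A *v v)"
    and B_adjoint: "cinner (B *v u) v = cinner u (B *v v)"
    and E_invariant: "\<lbrakk>i \<le> D; vec.subspace W; \<And>v. v \<in> W \<Longrightarrow> A *v v \<in> W; \<And>v. v \<in> W \<Longrightarrow> B *v v \<in> W; v \<in> W\<rbrakk>
        \<Longrightarrow> E i *v v \<in> W"
    and F_invariant: "\<lbrakk>i \<le> D; vec.subspace W; \<And>v. v \<in> W \<Longrightarrow> A *v v \<in> W; \<And>v. v \<in> W \<Longrightarrow> B *v v \<in> W; v \<in> W\<rbrakk>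
        \<Longrightarrow> F i *v v \<in> W"
begin

text \<open>Every result below can be reused with the two systems exchanged. The invariance
  properties get explicit proofs because their premises about \<open>A\<close> and \<open>B\<close>
  change order.\<close>

lemma dual: "dual_idempotent_systems B A F E \<phi> \<theta> D"
proof
  show "F i *v v \<in> W"
    if "i \<le> D" "vec.subspace W" "\<And>v. v \<in> W \<Longrightarrow> B *v v \<in> W" "\<And>v. v \<in> W \<Longrightarrow> A *v v \<in> W" "v \<in> W" for i W v
    by (rule F_invariant) (use that in auto)
  show "E i *v v \<in> W"
    if "i \<le> D" "vec.subspace W" "\<And>v. v \<in> W \<Longrightarrow> B *v v \<in> W" "\<And>v. v \<in> W \<Longrightarrow> A *v v \<in> W" "v \<in> W" for i W v
    by (rule E_invariant) (use that in auto)
qed (fact F_mult E_mult F_sum E_sum F_B E_A E_B_E F_A_F F_adjoint E_adjoint B_adjoint A_adjoint)+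

text \<open>
  The space \<open>V\<^sub>a\<^sub>b\<close>, expressed by vanishing components; unlike \<open>Vij\<close> it is also meaningful for indices
  above \<open>D\<close>, where it imposes no condition.
\<close>
definition flag :: "nat \<Rightarrow> nat \<Rightarrow> (complex^'n) set" where
  "flag a b = {v. (\<forall>h\<le>D. a < h \<longrightarrow> F h *v v = 0) \<and> (\<forall>h\<le>D. b < h \<longrightarrow> E h *v v = 0)}"

definition submodule :: "(complex^'n) set \<Rightarrow> bool" where
  "submodule W \<longleftrightarrow> vec.subspace W \<and> (\<forall>v\<in>W. A *v v \<in> W) \<and> (\<forall>v\<in>W. B *v v \<in> W)"

definition simple :: "(complex^'n) set \<Rightarrow> bool" where
  "simple W \<longleftrightarrow> submodule W \<and> W \<noteq> {0} \<and> (\<forall>U. submodule U \<and> U \<subseteq> W \<longrightarrow> U = {0} \<or> U = W)"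

lemma subspace_flag: "vec.subspace (flag a b)"
  by (auto simp: vec.subspace_def flag_def vec.add vec.scale)

lemma flag_mono: "a \<le> a' \<Longrightarrow> b \<le> b' \<Longrightarrow> flag a b \<subseteq> flag a' b'"
  by (auto simp: flag_def)

lemma submodule_subspace: "submodule W \<Longrightarrow> vec.subspace W"
  by (simp add: submodule_def)

lemma submodule_E: "submodule W \<Longrightarrow> i \<le> D \<Longrightarrow> v \<in> W \<Longrightarrow> E i *v v \<in> W"
  by (rule E_invariant) (auto simp: submodule_def)

lemma submodule_F: "submodule W \<Longrightarrow> i \<le> D \<Longrightarrow> v \<in> W \<Longrightarrow> F i *v v \<in> W"
  by (rule F_invariant) (auto simp: submodule_def)

lemma eq_0_if_E: "(\<And>i. i \<le> D \<Longrightarrow> E i *v v = 0) \<Longrightarrow> v = 0"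
  using E_sum[of v] by simp

text \<open>\<open>A - \<theta> b\<close> kills the \<open>E b\<close> component and only rescales
  the others, while the tridiagonal action of \<open>A\<close> reaches at most one further
  \<open>F\<close> component. For \<open>b = 0\<close> truncated subtraction leaves the index at
  \<open>0\<close>, so the vanishing is stated separately.\<close>

lemma flag_raise:
  assumes v: "v \<in> flag a b"
  shows "A *v v - \<theta> b *s v \<in> flag (Suc a) (b - 1)" "b = 0 \<Longrightarrow> A *v v - \<theta> b *s v = 0"
proof -
  let ?w = "A *v v - \<theta> b *s v"
  have E: "E k *v ?w = 0" if "k \<le> D" "b \<le> k" for k
    using that v by (cases "b = k") (auto simp: vec.diff vec.scale E_A flag_def)
  have F: "F k *v ?w = 0" if k: "k \<le> D" "Suc a < k" for k
  proof -
    have "F k *v (A *v v) = F k *v (A *v (\<Sum>h\<le>D. F h *v v))" by (simp add: F_sum)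
    also have "\<dots> = (\<Sum>h\<le>D. F k *v (A *v (F h *v v)))" by (simp add: vec.sum)
    also have "\<dots> = 0"
    proof (intro sum.neutral ballI)
      fix h assume h: "h \<in> {..D}"
      show "F k *v (A *v (F h *v v)) = 0"
      proof (cases "a < h")
        case True
        then show ?thesis using v h by (simp add: flag_def)
      next
        case False
        then show ?thesis using k h by (intro F_A_F) auto
      qed
    qed
    finally show ?thesis using k v by (simp add: vec.diff vec.scale flag_def)
  qed
  show "?w \<in> flag (Suc a) (b - 1)"
    unfolding flag_def mem_Collect_eq
  proof (intro conjI allI impI)
    show "F h *v ?w = 0" if "h \<le> D" "Suc a < h" for h using F that .
    show "E h *v ?w = 0" if "h \<le> D" "b - 1 < h" for h using that by (intro E) auto
  qed
  show "?w = 0" if "b = 0"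
    by (rule eq_0_if_E, rule E) (simp_all add: that)
qed

lemma exists_E_component:
  assumes "W \<noteq> {0}" "submodule W"
  shows "\<exists>i\<le>D. mimage (E i) W \<noteq> {0}"
proof -
  have "0 \<in> W" using assms by (simp add: submodule_def vec.subspace_0)
  then obtain v where v: "v \<in> W" "v \<noteq> 0" using assms(1) by auto
  then obtain i where "i \<le> D" "E i *v v \<noteq> 0" using eq_0_if_E[of v] by auto
  then show ?thesis using v(1) by (auto simp: mimage_def)
qed

lemma mimage_eq_0D: "mimage M W = {0} \<Longrightarrow> v \<in> W \<Longrightarrow> M *v v = 0"
  by (auto simp: mimage_def)

lemma mimage_eq_0_iff: "submodule W \<Longrightarrow> mimage M W = {0} \<longleftrightarrow> (\<forall>v\<in>W. M *v v = 0)"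
  using vec.subspace_0[of W] by (force simp: mimage_def submodule_def)

text \<open>The sum over an antidiagonal. Indices above \<open>D\<close> are allowed, where
  \<open>flag\<close> imposes no condition, so that moving along the antidiagonal needs no case
  distinction at \<open>D\<close>.\<close>

definition level_sum :: "(complex^'n) set \<Rightarrow> nat \<Rightarrow> (complex^'n) set" where
  "level_sum W c = vec.span (\<Union>a\<in>{..c}. flag a (c - a) \<inter> W)"

lemma level_sum_subset: "submodule W \<Longrightarrow> level_sum W c \<subseteq> W"
  unfolding level_sum_def by (intro vec.span_minimal) (auto simp: submodule_def)

lemma flag_subset_level_sum: "flag a b \<inter> W \<subseteq> level_sum W (a + b)"
proof
  fix v assume "v \<in> flag a b \<inter> W"
  then have "v \<in> (\<Union>k\<in>{..a + b}. flag k (a + b - k) \<inter> W)" by (intro UN_I[of a]) auto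
  then show "v \<in> level_sum W (a + b)" unfolding level_sum_def by (rule vec.span_base)
qed

text \<open>On a summand with index \<open>a\<close>, the part \<open>A - \<theta> (c - a)\<close>
  moves to the neighbouring flag on the same antidiagonal, and the scalar part stays.\<close>

lemma level_sum_A:
  assumes W: "submodule W" and v: "v \<in> level_sum W c"
  shows "A *v v \<in> level_sum W c"
  using v unfolding level_sum_def
proof (induction rule: vec.span_induct_alt)
  case base
  then show ?case by (simp add: vec.span_zero)
next
  case (step k u y)
  then obtain a where a: "a \<le> c" "u \<in> flag a (c - a)" "u \<in> W" by auto
  let ?w = "A *v u - \<theta> (c - a) *s u"
  have "?w \<in> level_sum W c"
  proof (cases "c - a = 0")
    case True
    \<comment> \<open>At the end of the antidiagonal there is no neighbour, but there the image is
      zero.\<close>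
    then show ?thesis using flag_raise(2)[OF a(2)] by (simp add: level_sum_def vec.span_zero)
  next
    case False
    have "?w \<in> W" using W a(3) by (auto simp: submodule_def intro!: vec.subspace_diff vec.subspace_scale)
    then have "?w \<in> level_sum W (Suc a + (c - a - 1))"
      using flag_raise(1)[OF a(2)] flag_subset_level_sum by blast
    then show ?thesis using False a(1) by simp
  qed
  moreover have "u \<in> level_sum W c"
    using flag_subset_level_sum[of a "c - a" W] a by auto
  ultimately have "?w + \<theta> (c - a) *s u \<in> level_sum W c"
    unfolding level_sum_def by (intro vec.span_add vec.span_scale)
  then have "A *v u \<in> level_sum W c" by simp
  then show ?case using step.IH
    unfolding level_sum_def by (simp add: vec.add vec.scale vec.span_add vec.span_scale)
qed

end

section \<open>Exchange of the two systems and supports of irreducible modules\<close>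

context dual_idempotent_systems
begin

interpretation dual: dual_idempotent_systems B A F E \<phi> \<theta> D
  by (rule dual)

lemma dual_flag: "dual.flag b a = flag a b"
  by (auto simp: flag_def dual.flag_def)

lemma dual_submodule: "dual.submodule = submodule"
  by (auto simp: fun_eq_iff submodule_def dual.submodule_def)

lemma dual_simple: "dual.simple = simple"
  by (simp add: fun_eq_iff simple_def dual.simple_def dual_submodule)

lemma dual_level_sum: "dual.level_sum W c = level_sum W c"
proof -
  have "(\<Union>a\<in>{..c}. dual.flag a (c - a) \<inter> W) = (\<Union>a\<in>{..c}. flag a (c - a) \<inter> W)"
    unfolding dual_flag
  proof (intro equalityI subsetI; elim UN_E)
    fix v a assume "a \<in> {..c}" "v \<in> flag (c - a) a \<inter> W"
    then show "v \<in> (\<Union>a\<in>{..c}. flag a (c - a) \<inter> W)" by (intro UN_I[of "c - a"]) auto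
  next
    fix v a assume "a \<in> {..c}" "v \<in> flag a (c - a) \<inter> W"
    then show "v \<in> (\<Union>a\<in>{..c}. flag (c - a) a \<inter> W)" by (intro UN_I[of "c - a"]) auto
  qed
  then show ?thesis by (simp add: level_sum_def dual.level_sum_def)
qed

text \<open>Invariance under \<open>B\<close> is invariance under \<open>A\<close> in the exchanged
  system, which has the same level sums.\<close>

lemma submodule_level_sum: "submodule W \<Longrightarrow> submodule (level_sum W c)"
  using level_sum_A[of W] dual.level_sum_A[of W]
  by (auto simp: submodule_def[of "level_sum W c"] dual_submodule dual_level_sum)
    (simp add: level_sum_def)

lemma simple_submodule: "simple W \<Longrightarrow> submodule W"
  by (simp add: simple_def)

lemma level_sum_eq_0_or_all:
  assumes "simple W"
  shows "level_sum W c = {0} \<or> level_sum W c = W"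
  using assms submodule_level_sum level_sum_subset unfolding simple_def by blast

text \<open>\<open>F m\<close> kills each summand \<open>flag d (a + b - d) \<inter> W\<close> of
  the level sum: if \<open>a + b - d < t\<close>, its vectors have no \<open>E\<close> component at
  all; otherwise \<open>d < m\<close>. As \<open>F m\<close> does not kill \<open>W\<close>,
  irreducibility leaves only the zero space.\<close>

lemma flag_eq_0_below:
  assumes W: "simple W" and m: "m \<le> D" "mimage (F m) W \<noteq> {0}"
    and t: "\<And>b. b < t \<Longrightarrow> b \<le> D \<Longrightarrow> mimage (E b) W = {0}" and ab: "a + b < m + t"
  shows "level_sum W (a + b) = {0}" "flag a b \<inter> W \<subseteq> {0}"
proof -
  note sW = simple_submodule[OF W]
  obtain v where v: "v \<in> W" "F m *v v \<noteq> 0"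
    using m mimage_eq_0_iff[OF sW] by auto
  have "F m *v u = 0" if "u \<in> level_sum W (a + b)" for u
    using that unfolding level_sum_def
  proof (induction rule: vec.span_induct_alt)
    case (step k u y)
    then obtain d where d: "d \<le> a + b" "u \<in> flag d (a + b - d)" "u \<in> W" by auto
    have "F m *v u = 0"
    proof (cases "a + b - d < t")
      case True
      have "E h *v u = 0" if "h \<le> D" for h
      proof (cases "a + b - d < h")
        case True
        then show ?thesis using d(2) that by (simp add: flag_def)
      next
        case False
        then have "mimage (E h) W = {0}" using True that by (intro t) auto
        then show ?thesis using d(3) by (rule mimage_eq_0D)
      qed
      then have "u = 0" by (rule eq_0_if_E)
      then show ?thesis by simp
    next
      case False
      then show ?thesis using ab d(1,2) m(1) by (simp add: flag_def)
    qed
    then show ?case using step.IH by (simp add: vec.add vec.scale)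
  qed simp
  then show *: "level_sum W (a + b) = {0}"
    using level_sum_eq_0_or_all[OF W] v by blast
  then show "flag a b \<inter> W \<subseteq> {0}"
    using flag_subset_level_sum by blast
qed

text \<open>
  A gap in the support would make the part of \<open>W\<close> below the gap a proper nonzero submodule.
\<close>
lemma support_F_interval:
  assumes W: "simple W" and lo: "l \<le> D" "mimage (F l) W \<noteq> {0}" and hi: "m \<le> D" "mimage (F m) W \<noteq> {0}"
    and r: "l < r" "r < m"
  shows "mimage (F r) W \<noteq> {0}"
proof
  assume F0: "mimage (F r) W = {0}"
  note sW = simple_submodule[OF W]
  have rD: "r \<le> D" using r hi by simp
  define U where "U = W \<inter> {v. \<forall>h\<le>D. r \<le> h \<longrightarrow> F h *v v = 0}"
  have "vec.subspace U"
    using sW by (auto simp: U_def vec.subspace_def submodule_def vec.add vec.scale)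
  moreover have "B *v v \<in> U" if "v \<in> U" for v
    using that sW by (auto simp: U_def submodule_def F_B)
  moreover have "A *v v \<in> U" if v: "v \<in> U" for v
  proof -
    have AW: "A *v v \<in> W" using v sW by (auto simp: U_def submodule_def)
    have "F h *v (A *v v) = 0" if h: "h \<le> D" "r \<le> h" for h
    proof (cases "h = r")
      case True
      then show ?thesis using mimage_eq_0D[OF F0 AW] by simp
    next
      case False
      have "F h *v (A *v v) = F h *v (A *v (\<Sum>k\<le>D. F k *v v))" by (simp add: F_sum)
      also have "\<dots> = (\<Sum>k\<le>D. F h *v (A *v (F k *v v)))" by (simp add: vec.sum)
      also have "\<dots> = 0"
      proof (intro sum.neutral ballI)
        fix k assume k: "k \<in> {..D}"
        show "F h *v (A *v (F k *v v)) = 0"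
        proof (cases "r \<le> k")
          case True
          then show ?thesis using v k by (simp add: U_def)
        next
          case k': False
          \<comment> \<open>Here \<open>k < r < h\<close>, so the indices differ by at least
            two.\<close>
          then show ?thesis using k h False by (intro F_A_F) auto
        qed
      qed
      finally show ?thesis .
    qed
    then show ?thesis using AW by (simp add: U_def)
  qed
  ultimately have "submodule U" by (simp add: submodule_def)
  moreover have "U \<subseteq> W" by (auto simp: U_def)
  ultimately have U: "U = {0} \<or> U = W" using W by (auto simp: simple_def)
  obtain v where v: "v \<in> W" "F l *v v \<noteq> 0" using lo mimage_eq_0_iff[OF sW] by auto
  have "F l *v v \<in> U"
    using v lo r submodule_F[OF sW] by (auto simp: U_def F_mult)
  moreover obtain w where w: "w \<in> W" "F m *v w \<noteq> 0" using hi mimage_eq_0_iff[OF sW] by auto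
  moreover have "w \<notin> U" using w hi r by (auto simp: U_def)
  ultimately show False using U v by auto
qed

text \<open>For an irreducible module this is \<open>D\<close> plus the displacement.\<close>
definition height :: "(complex^'n) set \<Rightarrow> nat" where
  "height W = (LEAST i. mimage (F i) W \<noteq> {0}) + (LEAST i. mimage (E i) W \<noteq> {0})
     + (card {i. i \<le> D \<and> mimage (F i) W \<noteq> {0}} - 1)"

text \<open>\<open>LEAST\<close> ranges over all naturals, including indices above \<open>D\<close>
  where the matrices are unspecified. One nonzero component with index at most \<open>D\<close>
  keeps the minimum in range.\<close>

lemma Least_component:
  assumes "i \<le> D" "mimage (G i) W \<noteq> {0}"
  shows "(LEAST i. mimage (G i) W \<noteq> {0}) \<le> D"
    "mimage (G (LEAST i. mimage (G i) W \<noteq> {0})) W \<noteq> {0}"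
    "b < (LEAST i. mimage (G i) W \<noteq> {0}) \<Longrightarrow> mimage (G b) W = {0}"
  using Least_le[of "\<lambda>i. mimage (G i) W \<noteq> {0}", OF assms(2)] assms(1)
    LeastI[of "\<lambda>i. mimage (G i) W \<noteq> {0}", OF assms(2)] not_less_Least[of b "\<lambda>i. mimage (G i) W \<noteq> {0}"]
  by auto

text \<open>The witness is \<open>F l *v v\<close>: its only \<open>F\<close> component has index
  \<open>l\<close>, and it stays in \<open>W\<close>, which has no \<open>E\<close> component above
  \<open>N\<close>.\<close>

lemma flag_corner:
  assumes W: "simple W" and l: "l \<le> D" "mimage (F l) W \<noteq> {0}"
    and N: "\<And>h. h \<le> D \<Longrightarrow> N < h \<Longrightarrow> mimage (E h) W = {0}"
  shows "\<not> flag l N \<inter> W \<subseteq> {0}"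
proof -
  note sW = simple_submodule[OF W]
  obtain v where v: "v \<in> W" "F l *v v \<noteq> 0" using l mimage_eq_0_iff[OF sW] by auto
  have "F l *v v \<in> W" using submodule_F sW l v by simp
  moreover from this have "F l *v v \<in> flag l N"
    using l(1) mimage_eq_0D[OF N] by (auto simp: flag_def F_mult)
  ultimately show ?thesis using v by auto
qed

end

section \<open>Flags inside an irreducible module\<close>

context dual_idempotent_systems
begin

interpretation dual: dual_idempotent_systems B A F E \<phi> \<theta> D
  by (rule dual)

text \<open>Let the \<open>F\<close> support be \<open>{l..M}\<close> and let the \<open>E\<close>
  support have minimum \<open>t\<close> and maximum \<open>N\<close>. The flags at
  \<open>(l, N)\<close> and \<open>(M, t)\<close> meet \<open>W\<close> nontrivially, while those
  with index sum below \<open>M + t\<close>, and by exchange below \<open>l + N\<close>, do not.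
  Hence \<open>M + t = l + N\<close>, and the level sum there is nonzero, so it is
  \<open>W\<close>.\<close>

lemma simple_split:
  assumes W: "simple W"
  shows "a + b < height W \<Longrightarrow> flag a b \<inter> W \<subseteq> {0}" "level_sum W (height W) = W"
proof -
  note sW = simple_submodule[OF W]
  define S where "S = {i. i \<le> D \<and> mimage (F i) W \<noteq> {0}}"
  define S' where "S' = {i. i \<le> D \<and> mimage (E i) W \<noteq> {0}}"
  define l where "l = (LEAST i. mimage (F i) W \<noteq> {0})"
  define t where "t = (LEAST i. mimage (E i) W \<noteq> {0})"
  define M where "M = Max S"
  define N where "N = Max S'"
  have fin: "finite S" "finite S'" by (auto simp: S_def S'_def)
  have W0: "W \<noteq> {0}" using W by (simp add: simple_def)
  obtain i where i: "i \<le> D" "mimage (E i) W \<noteq> {0}" using exists_E_component[OF W0 sW] by auto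
  obtain i' where i': "i' \<le> D" "mimage (F i') W \<noteq> {0}"
    using dual.exists_E_component[OF W0] sW by (auto simp: dual_submodule)
  note t = Least_component[of i E W, OF i, folded t_def] and l = Least_component[of i' F W, OF i', folded l_def]
  have M: "M \<in> S" unfolding M_def using fin i' by (intro Max_in) (auto simp: S_def)
  have N: "N \<in> S'" unfolding N_def using fin i by (intro Max_in) (auto simp: S'_def)
  have Mmax: "mimage (F h) W = {0}" if "h \<le> D" "M < h" for h
  proof -
    have "h \<notin> S" using that Max_ge[OF fin(1), of h] by (auto simp: M_def)
    then show ?thesis using that by (simp add: S_def)
  qed
  have Nmax: "mimage (E h) W = {0}" if "h \<le> D" "N < h" for h
  proof -
    have "h \<notin> S'" using that Max_ge[OF fin(2), of h] by (auto simp: N_def)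
    then show ?thesis using that by (simp add: S'_def)
  qed
  have S_eq: "S = {l..M}"
  proof (intro equalityI subsetI)
    fix h assume "h \<in> S"
    then show "h \<in> {l..M}" using l(3)[of h] Mmax[of h] by (force simp: S_def not_less[symmetric])
  next
    fix h assume h: "h \<in> {l..M}"
    then show "h \<in> S"
      using M l support_F_interval[OF W l(1,2), of M h]
      by (cases "h = l \<or> h = M") (auto simp: S_def)
  qed
  have lM: "l \<le> M" using M S_eq by auto
  have "height W = l + t + (card S - 1)" by (simp add: height_def l_def t_def S_def)
  \<comment> \<open>\<open>card {l..M} - 1 = M - l\<close>, so the endpoint \<open>l\<close>
    cancels.\<close>
  then have height: "height W = M + t" using lM by (simp add: S_eq)
  have below: "a + b < M + t \<Longrightarrow> level_sum W (a + b) = {0} \<and> flag a b \<inter> W \<subseteq> {0}" for a b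
    using flag_eq_0_below[OF W, of M t a b] M t(3) by (auto simp: S_def)
  have below': "a + b < N + l \<Longrightarrow> flag a b \<inter> W \<subseteq> {0}" for a b
    using dual.flag_eq_0_below(2)[of W N l b a] N l(3) W
    by (auto simp: S'_def dual_flag dual_simple)
  have corner: "\<not> flag l N \<inter> W \<subseteq> {0}"
    using flag_corner[OF W l(1,2)] Nmax by blast
  have corner': "\<not> flag M t \<inter> W \<subseteq> {0}"
    using dual.flag_corner[of W t M] W t Mmax by (simp add: dual_flag dual_simple)
  have eq: "M + t = l + N"
  proof -
    have "\<not> l + N < M + t" using below[of l N] corner by blast
    moreover have "\<not> M + t < N + l" using below'[of M t] corner' by blast
    ultimately show ?thesis by linarith
  qed
  show "flag a b \<inter> W \<subseteq> {0}" if "a + b < height W"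
    using that below height by simp
  have "level_sum W (l + N) \<noteq> {0}"
    using flag_subset_level_sum[of l N W] corner by auto
  then show "level_sum W (height W) = W"
    using level_sum_eq_0_or_all[OF W, of "l + N"] height eq by simp
qed

text \<open>The index \<open>D\<close> imposes no condition, so the two constraints can be treated
  separately.\<close>

lemma flag_eq_Int: "flag a b = flag a D \<inter> flag D b"
  by (auto simp: flag_def)

text \<open>Write \<open>v\<close> as a sum of vectors \<open>w a\<close> in
  \<open>flag a (c - a)\<close>. The terms with \<open>a > r\<close> add up to a vector that
  satisfies the \<open>F\<close> constraint of \<open>v\<close> and an \<open>E\<close> constraint
  too strong for the height, so their sum is zero. The remaining terms with \<open>c - a > s\<close>
  drop out in the same way.\<close>

lemma flag_simple_split:
  assumes W: "simple W" and v: "v \<in> flag r s \<inter> W"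
  shows "v \<in> vec.span (\<Union> {flag a b \<inter> W | a b. a \<le> r \<and> b \<le> s \<and> a + b = height W})"
proof -
  note sW = simple_submodule[OF W]
  define c where "c = height W"
  have sub: "vec.subspace (flag a b \<inter> W)" for a b
    using subspace_flag sW by (simp add: vec.subspace_inter submodule_def)
  have "v \<in> vec.span (\<Union>a\<in>{..c}. flag a (c - a) \<inter> W)"
    using simple_split(2)[OF W] v by (simp add: level_sum_def c_def)
  then obtain w where w: "\<And>a. a \<in> {..c} \<Longrightarrow> w a \<in> flag a (c - a) \<inter> W" and vw: "v = (\<Sum>a\<le>c. w a)"
    by (rule span_UN_subspaces[rotated 2]) (use sub in auto)
  have wF: "w a \<in> flag a' D \<inter> W" if "a \<le> c" "a \<le> a'" for a a'
    using w[of a] that by (auto simp: flag_def)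
  have wE: "w a \<in> flag D b' \<inter> W" if "a \<le> c" "c - a \<le> b'" for a b'
    using w[of a] that by (auto simp: flag_def)
  have vF: "v \<in> flag r D \<inter> W" and vE: "v \<in> flag D s \<inter> W" using v by (auto simp: flag_def)
  define R where "R = {a\<in>{..c}. a \<le> r}"
  have v1: "v = sum w R"
  proof -
    let ?y = "sum w ({..c} - R)"
    have y: "?y = v - sum w R" unfolding vw by (subst sum_diff) (auto simp: R_def)
    have "?y = 0"
    proof (cases "r < c")
      case True
      have "?y \<in> flag r D \<inter> W" unfolding y
        by (intro vec.subspace_diff[OF sub vF] vec.subspace_sum[OF sub] wF) (auto simp: R_def)
      moreover have "?y \<in> flag D (c - r - 1) \<inter> W"
        by (intro vec.subspace_sum[OF sub] wE) (auto simp: R_def)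
      ultimately have "?y \<in> flag r (c - r - 1) \<inter> W" by (subst flag_eq_Int) auto
      \<comment> \<open>The indices add up to \<open>c - 1\<close>, below the height of
        \<open>W\<close>.\<close>
      then show ?thesis using simple_split(1)[OF W, of r "c - r - 1"] True by (auto simp: c_def)
    next
      case False
      then have "{..c} - R = {}" by (auto simp: R_def)
      then show ?thesis by (simp only: sum.empty)
    qed
    then show ?thesis using y by simp
  qed
  define K where "K = {a\<in>R. c - a \<le> s}"
  have v2: "v = sum w K"
  proof -
    let ?z = "sum w (R - K)"
    have z: "?z = v - sum w K" unfolding v1 by (subst sum_diff) (auto simp: R_def K_def)
    have "?z = 0"
    proof (cases "s < c")
      case True
      have "?z \<in> flag D s \<inter> W" unfolding z
        by (intro vec.subspace_diff[OF sub vE] vec.subspace_sum[OF sub] wE) (auto simp: R_def K_def)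
      moreover have "?z \<in> flag (c - s - 1) D \<inter> W"
        by (intro vec.subspace_sum[OF sub] wF) (auto simp: R_def K_def)
      ultimately have "?z \<in> flag (c - s - 1) s \<inter> W" by (subst flag_eq_Int) auto
      then show ?thesis using simple_split(1)[OF W, of "c - s - 1" s] True by (auto simp: c_def)
    next
      case False
      then have "R - K = {}" by (auto simp: R_def K_def)
      then show ?thesis by (simp only: sum.empty)
    qed
    then show ?thesis using z by simp
  qed
  show ?thesis unfolding v2
  proof (intro vec.span_sum vec.span_base)
    fix a assume a: "a \<in> K"
    then have "w a \<in> flag a (c - a) \<inter> W" "a \<le> r \<and> c - a \<le> s \<and> a + (c - a) = height W"
      using w[of a] by (auto simp: K_def R_def c_def)
    then show "w a \<in> \<Union> {flag a b \<inter> W |a b. a \<le> r \<and> b \<le> s \<and> a + b = height W}"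
      by blast
  qed
qed

end

section \<open>Orthogonality of submodules\<close>

context dual_idempotent_systems
begin

lemma submodule_perp:
  assumes U: "submodule U"
  shows "submodule (perp U)"
  using U subspace_orthogonal_to[of U]
  by (auto simp: submodule_def perp_def A_adjoint[symmetric] B_adjoint[symmetric])

lemma submodule_Int: "submodule U \<Longrightarrow> submodule W \<Longrightarrow> submodule (U \<inter> W)"
  by (auto simp: submodule_def vec.subspace_inter)

text \<open>If \<open>E i\<close> killed \<open>W'\<close>, self-adjointness would put
  \<open>E i *v v\<close> into \<open>W \<inter> perp W'\<close> for every \<open>v\<close> in
  \<open>W\<close>.\<close>

lemma support_E_subset:
  assumes "W \<inter> perp W' = {0}" "submodule W" and i: "i \<le> D" "mimage (E i) W \<noteq> {0}"
  shows "mimage (E i) W' \<noteq> {0}"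
proof
  assume 0: "mimage (E i) W' = {0}"
  obtain v where v: "v \<in> W" "E i *v v \<noteq> 0" using i mimage_eq_0_iff[OF assms(2)] by auto
  have "cinner u (E i *v v) = 0" if "u \<in> W'" for u
    using mimage_eq_0D[OF 0 that] E_adjoint[OF i(1), of u v] by simp
  then have "E i *v v \<in> W \<inter> perp W'"
    using submodule_E[OF assms(2) i(1) v(1)] by (simp add: perp_def)
  then show False using v assms(1) by auto
qed

end

context dual_idempotent_systems
begin

interpretation dual: dual_idempotent_systems B A F E \<phi> \<theta> D
  by (rule dual)

text \<open>
  If two irreducible modules are not orthogonal, the inner product pairs them nondegenerately, so they
  have the same components and hence the same height.
\<close>
lemma simple_perp:
  assumes W: "simple W" and W': "simple W'" and ne: "height W \<noteq> height W'"
  shows "W' \<subseteq> perp W"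
proof (rule ccontr)
  assume *: "\<not> W' \<subseteq> perp W"
  note sW = simple_submodule[OF W] and sW' = simple_submodule[OF W']
  have "W' \<inter> perp W = {0} \<or> W' \<inter> perp W = W'"
    using W' submodule_Int[OF sW' submodule_perp[OF sW]] by (auto simp: simple_def)
  with * have 1: "W' \<inter> perp W = {0}" by auto
  have "W \<inter> perp W' = {0} \<or> W \<inter> perp W' = W"
    using W submodule_Int[OF sW submodule_perp[OF sW']] by (auto simp: simple_def)
  moreover have "\<not> W \<subseteq> perp W'" using * perp_sym by blast
  ultimately have 2: "W \<inter> perp W' = {0}" by auto
  have E: "mimage (E i) W \<noteq> {0} \<longleftrightarrow> mimage (E i) W' \<noteq> {0}" if "i \<le> D" for i
    using support_E_subset[OF 1 sW' that] support_E_subset[OF 2 sW that] by blast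
  have F: "mimage (F i) W \<noteq> {0} \<longleftrightarrow> mimage (F i) W' \<noteq> {0}" if "i \<le> D" for i
    using dual.support_E_subset[OF 1 _ that] dual.support_E_subset[OF 2 _ that] sW sW'
    by (auto simp: dual_submodule)
  \<comment> \<open>The supports are known to agree only up to \<open>D\<close>, so both least
    indices are first located there.\<close>
  have Least: "(LEAST i. mimage (G i) W \<noteq> {0}) = (LEAST i. mimage (G i) W' \<noteq> {0})"
    if ex: "\<exists>i\<le>D. mimage (G i) W \<noteq> {0}"
      and G: "\<And>i. i \<le> D \<Longrightarrow> mimage (G i) W \<noteq> {0} \<longleftrightarrow> mimage (G i) W' \<noteq> {0}"
    for G :: "nat \<Rightarrow> complex^'n^'n"
  proof (rule antisym)
    obtain i where i: "i \<le> D" "mimage (G i) W \<noteq> {0}" "mimage (G i) W' \<noteq> {0}" using ex G by blast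
    show "(LEAST i. mimage (G i) W \<noteq> {0}) \<le> (LEAST i. mimage (G i) W' \<noteq> {0})"
      using Least_component(1,2)[of i G W', OF i(1,3)] G by (intro Least_le) blast
    show "(LEAST i. mimage (G i) W' \<noteq> {0}) \<le> (LEAST i. mimage (G i) W \<noteq> {0})"
      using Least_component(1,2)[of i G W, OF i(1,2)] G by (intro Least_le) blast
  qed
  have W0: "W \<noteq> {0}" using W by (simp add: simple_def)
  have "height W = height W'"
    unfolding height_def
    using Least[of E, OF exists_E_component[OF W0 sW] E]
      Least[of F, OF dual.exists_E_component[OF W0] F] F sW
    by (auto simp: dual_submodule cong: conj_cong)
  with ne show False by simp
qed

section \<open>Orthogonal decomposition into irreducible modules\<close>

definition orthogonal_family :: "(complex^'n) set set \<Rightarrow> bool" where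
  "orthogonal_family \<W> \<longleftrightarrow> finite \<W> \<and> (\<forall>W\<in>\<W>. simple W) \<and>
     (\<forall>W\<in>\<W>. \<forall>W'\<in>\<W>. W \<noteq> W' \<longrightarrow> W' \<subseteq> perp W)"

text \<open>A nonzero submodule of least dimension inside \<open>M\<close> is irreducible.\<close>

lemma exists_simple:
  assumes M: "submodule M" "M \<noteq> {0}"
  obtains W where "simple W" "W \<subseteq> M"
proof -
  let ?P = "\<lambda>W. submodule W \<and> W \<noteq> {0} \<and> W \<subseteq> M"
  obtain W where W: "?P W" and min: "\<And>U. ?P U \<Longrightarrow> vec.dim W \<le> vec.dim U"
    using ex_has_least_nat[of ?P M vec.dim] M by auto
  have "U = {0} \<or> U = W" if U: "submodule U" "U \<subseteq> W" for U
  proof (cases "U = {0}")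
    case False
    then have "vec.dim W \<le> vec.dim U" using U W by (intro min) auto
    then show ?thesis using U W vec.subspace_dim_equal[of U W] by (auto simp: submodule_def)
  qed simp
  then have "simple W" using W by (simp add: simple_def)
  then show ?thesis using W that by blast
qed

text \<open>Split off an irreducible \<open>W\<close> and continue with
  \<open>M \<inter> perp W\<close>. Its dimension is smaller because a nonzero vector of
  \<open>W\<close> is not orthogonal to itself, and orthogonal projection recovers \<open>M\<close>
  from the two parts.\<close>

lemma exists_orthogonal_family:
  assumes "submodule M"
  shows "\<exists>\<W>. orthogonal_family \<W> \<and> (\<forall>W\<in>\<W>. W \<subseteq> M) \<and> M \<subseteq> vec.span (\<Union>\<W>)"
  using assms
proof (induction "vec.dim M" arbitrary: M rule: less_induct)
  case less
  show ?case
  proof (cases "M = {0}")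
    case True
    then show ?thesis
      by (intro exI[of _ "{}"]) (simp add: orthogonal_family_def vec.span_zero)
  next
    case False
    obtain W where W: "simple W" "W \<subseteq> M" using exists_simple[OF less.prems False] .
    note sW = simple_submodule[OF W(1)]
    let ?M = "M \<inter> perp W"
    have sM: "submodule ?M" using less.prems sW by (intro submodule_Int submodule_perp)
    obtain v where v: "v \<in> W" "v \<noteq> 0"
      using W(1) sW vec.subspace_0[of W] unfolding simple_def submodule_def by blast
    have "v \<notin> perp W" using v by (auto simp: perp_def intro!: bexI[of _ v])
    then have "?M \<subset> M" using v W(2) by auto
    then have "vec.dim ?M < vec.dim M"
      using less.prems sM by (intro vec.dim_psubset) (simp add: submodule_def vec.span_eq_iff[THEN iffD2])
    from less.hyps[OF this sM] obtain \<W> where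
      \<W>: "orthogonal_family \<W>" "\<forall>W\<in>\<W>. W \<subseteq> ?M" "?M \<subseteq> vec.span (\<Union>\<W>)" by auto
    have "orthogonal_family (insert W \<W>)"
    proof -
      have "W' \<subseteq> perp W" "W \<subseteq> perp W'" if "W' \<in> \<W>" for W'
        using that \<W>(2) perp_sym[of W' W] by auto
      then show ?thesis using \<W>(1) W(1) unfolding orthogonal_family_def by (metis finite_insert insert_iff)
    qed
    moreover have "M \<subseteq> vec.span (\<Union> (insert W \<W>))"
    proof
      fix v assume v: "v \<in> M"
      obtain w z where wz: "w \<in> W" "\<And>u. u \<in> W \<Longrightarrow> cinner u z = 0" "v = w + z"
        using complex_orthogonal_decomp[OF submodule_subspace[OF sW], of v] by blast
      have "z = v - w" using wz(3) by simp
      then have "z \<in> M" using v wz(1) W(2) less.prems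
        by (auto simp: submodule_def intro: vec.subspace_diff)
      then have "z \<in> vec.span (\<Union>\<W>)" using wz(2) \<W>(3) by (auto simp: perp_def)
      then have "z \<in> vec.span (\<Union> (insert W \<W>))" using vec.span_mono[of "\<Union>\<W>" "\<Union> (insert W \<W>)"] by auto
      moreover have "w \<in> vec.span (\<Union> (insert W \<W>))" using wz(1) by (intro vec.span_base) auto
      ultimately show "v \<in> vec.span (\<Union> (insert W \<W>))" unfolding wz(3) by (rule vec.span_add[rotated])
    qed
    ultimately show ?thesis using \<W>(2) W(2) by (intro exI[of _ "insert W \<W>"]) auto
  qed
qed

lemma cinner_family:
  assumes "orthogonal_family \<W>" "\<And>W. W \<in> \<W> \<Longrightarrow> w W \<in> W" "W \<in> \<W>" "u \<in> W"
  shows "cinner u (\<Sum>W\<in>\<W>. w W) = cinner u (w W)" "cinner (\<Sum>W\<in>\<W>. w W) u = cinner (w W) u"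
proof -
  have *: "cinner u (w W') = (if W' = W then cinner u (w W) else 0)" if "W' \<in> \<W>" for W'
  proof (cases "W' = W")
    case False
    then have "W' \<subseteq> perp W" using assms(1,3) that by (auto simp: orthogonal_family_def)
    then show ?thesis using False assms(2)[OF that] assms(4) by (auto simp: perp_def)
  qed simp
  show "cinner u (\<Sum>W\<in>\<W>. w W) = cinner u (w W)"
  proof -
    have "cinner u (\<Sum>W\<in>\<W>. w W) = (\<Sum>W'\<in>\<W>. if W' = W then cinner u (w W) else 0)"
      unfolding cinner_sum_right by (rule sum.cong[OF refl *])
    then show ?thesis using assms(1,3) by (simp add: orthogonal_family_def)
  qed
  then show "cinner (\<Sum>W\<in>\<W>. w W) u = cinner (w W) u"
    by (metis cinner_commute)
qed

lemma family_sum_eq_0: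
  assumes "orthogonal_family \<W>" "\<And>W. W \<in> \<W> \<Longrightarrow> w W \<in> W" "(\<Sum>W\<in>\<W>. w W) = 0" "W \<in> \<W>"
  shows "w W = 0"
  using cinner_family(1)[OF assms(1,2,4), of "w W"] assms by simp

text \<open>Each \<open>F h\<close> and \<open>E h\<close> preserves every member of the family, so
  a vanishing component of the sum vanishes member by member.\<close>

lemma flag_components:
  assumes \<W>: "orthogonal_family \<W>" "\<And>W. W \<in> \<W> \<Longrightarrow> w W \<in> W"
    and v: "(\<Sum>W\<in>\<W>. w W) \<in> flag a b" and W: "W \<in> \<W>"
  shows "w W \<in> flag a b"
proof -
  have sub: "submodule W" if "W \<in> \<W>" for W
    using \<W>(1) that by (auto simp: orthogonal_family_def simple_def)
  have "F h *v w W = 0" if h: "h \<le> D" "a < h" for h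
  proof (rule family_sum_eq_0[OF \<W>(1) _ _ W])
    show "F h *v w W \<in> W" if "W \<in> \<W>" for W using submodule_F[OF sub h(1)] \<W>(2) that by simp
    show "(\<Sum>W\<in>\<W>. F h *v w W) = 0" using v h by (simp add: flag_def vec.sum)
  qed
  moreover have "E h *v w W = 0" if h: "h \<le> D" "b < h" for h
  proof (rule family_sum_eq_0[OF \<W>(1) _ _ W])
    show "E h *v w W \<in> W" if "W \<in> \<W>" for W using submodule_E[OF sub h(1)] \<W>(2) that by simp
    show "(\<Sum>W\<in>\<W>. E h *v w W) = 0" using v h by (simp add: flag_def vec.sum)
  qed
  ultimately show ?thesis by (simp add: flag_def)
qed

text \<open>The abstract form of \<open>Vtilde\<close>. The guards replace the index
  \<open>-1\<close>, where the space is zero and orthogonality is no condition.\<close>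

definition flag_top :: "nat \<Rightarrow> nat \<Rightarrow> (complex^'n) set" where
  "flag_top r s = {v \<in> flag r s. (0 < s \<longrightarrow> v \<in> perp (flag r (s - 1))) \<and> (0 < r \<longrightarrow> v \<in> perp (flag (r - 1) s))}"

text \<open>Everything is read off along one fixed orthogonal family. For the left side, components
  of height other than \<open>k\<close> vanish by orthogonality, and those of height
  \<open>k\<close> split into flags lying in \<open>flag_top\<close>. For the right side, components
  of height above \<open>k\<close> vanish by \<open>simple_split\<close>, and those of lower height
  lie in strictly smaller flags, to which the vector is orthogonal.\<close>

theorem flag_Int_height:
  "flag i j \<inter> vec.span (\<Union> {W. simple W \<and> height W = k}) =
   vec.span (\<Union> {flag_top r s | r s. r \<le> i \<and> s \<le> j \<and> r + s = k})"
proof -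
  have "submodule UNIV" by (simp add: submodule_def)
  then obtain \<W> where \<W>: "orthogonal_family \<W>" and span: "vec.span (\<Union>\<W>) = UNIV"
    using exists_orthogonal_family[of UNIV] by auto
  have simple: "simple W" if "W \<in> \<W>" for W using \<W> that by (auto simp: orthogonal_family_def)
  have fin: "finite \<W>" using \<W> by (simp add: orthogonal_family_def)
  have decomp: "\<exists>w. (\<forall>W\<in>\<W>. w W \<in> W) \<and> v = (\<Sum>W\<in>\<W>. w W)" for v
    by (rule span_UN_subspaces[of \<W> "\<lambda>W. W" v])
      (use fin simple span in \<open>auto simp: simple_def submodule_def\<close>)
  have top: "flag a b \<inter> W \<subseteq> flag_top a b" if W: "W \<in> \<W>" "height W = a + b" for a b W
  proof
    fix y assume y: "y \<in> flag a b \<inter> W"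
    \<comment> \<open>Only the \<open>W\<close> component of a vector of \<open>flag a' b'\<close>
      pairs with \<open>y\<close>, and that component is zero since \<open>a' + b'\<close> is below
      the height of \<open>W\<close>.\<close>
    have *: "y \<in> perp (flag a' b')" if lt: "a' + b' < a + b" for a' b'
      unfolding perp_def mem_Collect_eq
    proof
      fix u assume u: "u \<in> flag a' b'"
      obtain w where w: "\<And>W. W \<in> \<W> \<Longrightarrow> w W \<in> W" "u = (\<Sum>W\<in>\<W>. w W)" using decomp by metis
      have "w W \<in> flag a' b' \<inter> W" using flag_components[of \<W> w a' b' W, OF \<W> w(1) _ W(1)] u w(1)[OF W(1)] w(2) by simp
      then have "w W = 0" using simple_split(1)[OF simple[OF W(1)], of a' b'] lt W(2) by auto
      then show "cinner u y = 0" using cinner_family(2)[OF \<W> w(1) W(1), of y] y w(2) by simp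
    qed
    then show "y \<in> flag_top a b" using y by (auto simp: flag_top_def)
  qed
  show ?thesis
  proof (intro equalityI subsetI)
    fix v assume v: "v \<in> flag i j \<inter> vec.span (\<Union> {W. simple W \<and> height W = k})"
    obtain w where w: "\<And>W. W \<in> \<W> \<Longrightarrow> w W \<in> W" "v = (\<Sum>W\<in>\<W>. w W)" using decomp by metis
    have "w W \<in> vec.span (\<Union> {flag_top r s | r s. r \<le> i \<and> s \<le> j \<and> r + s = k})" if W: "W \<in> \<W>" for W
    proof (cases "height W = k")
      case False
      have "cinner v (w W) = 0"
      proof (rule cinner_span_left_eq_0)
        show "v \<in> vec.span (\<Union> {W. simple W \<and> height W = k})" using v by simp
        fix u assume "u \<in> \<Union> {W. simple W \<and> height W = k}"
        then obtain W' where "u \<in> W'" "simple W'" "height W' = k" by auto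
        then show "cinner u (w W) = 0"
          using simple_perp[of W' W] simple[OF W] w(1)[OF W] False by (auto simp: perp_def)
      qed
      then have "w W = 0" using cinner_family(2)[OF \<W> w(1) W, of "w W"] w W by simp
      then show ?thesis by (simp add: vec.span_zero)
    next
      case True
      have "w W \<in> flag i j \<inter> W" using flag_components[of \<W> w i j W, OF \<W> w(1) _ W] v w(1)[OF W] w(2) by simp
      then have "w W \<in> vec.span (\<Union> {flag a b \<inter> W | a b. a \<le> i \<and> b \<le> j \<and> a + b = k})"
        using flag_simple_split[OF simple[OF W]] True by simp
      moreover have "\<Union> {flag a b \<inter> W | a b. a \<le> i \<and> b \<le> j \<and> a + b = k} \<subseteq>
          \<Union> {flag_top r s | r s. r \<le> i \<and> s \<le> j \<and> r + s = k}"
      proof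
        fix u assume "u \<in> \<Union> {flag a b \<inter> W | a b. a \<le> i \<and> b \<le> j \<and> a + b = k}"
        then obtain a b where ab: "u \<in> flag a b \<inter> W" "a \<le> i \<and> b \<le> j \<and> a + b = k" by auto
        then have "u \<in> flag_top a b" using top[OF W, of a b] True by auto
        then show "u \<in> \<Union> {flag_top r s | r s. r \<le> i \<and> s \<le> j \<and> r + s = k}" using ab(2) by auto
      qed
      ultimately show ?thesis using vec.span_mono by blast
    qed
    then show "v \<in> vec.span (\<Union> {flag_top r s | r s. r \<le> i \<and> s \<le> j \<and> r + s = k})"
      unfolding w(2) by (rule vec.span_sum)
  next
    have "v \<in> flag i j \<inter> vec.span (\<Union> {W. simple W \<and> height W = k})"
      if v: "v \<in> flag_top r s" and rs: "r \<le> i" "s \<le> j" "r + s = k" for v r s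
    proof
      show "v \<in> flag i j" using v flag_mono[OF rs(1,2)] by (auto simp: flag_top_def)
      obtain w where w: "\<And>W. W \<in> \<W> \<Longrightarrow> w W \<in> W" "v = (\<Sum>W\<in>\<W>. w W)" using decomp by metis
      have "w W \<in> vec.span (\<Union> {W. simple W \<and> height W = k})" if W: "W \<in> \<W>" for W
      proof -
        have wf: "w W \<in> flag r s \<inter> W" using flag_components[of \<W> w r s W, OF \<W> w(1) _ W] v w(1)[OF W] w(2) by (simp add: flag_top_def)
        consider "height W = k" | "k < height W" | "height W < k" by linarith
        then show ?thesis
        proof cases
          case 1
          then show ?thesis using simple[OF W] w(1)[OF W] by (intro vec.span_base) auto
        next
          case 2
          then have "w W = 0" using simple_split(1)[OF simple[OF W], of r s] wf rs by auto
          then show ?thesis by (simp add: vec.span_zero)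
        next
          case 3
          have "cinner (w W) v = 0"
          proof (rule cinner_span_left_eq_0[OF flag_simple_split[OF simple[OF W] wf]])
            fix u assume "u \<in> \<Union> {flag a b \<inter> W |a b. a \<le> r \<and> b \<le> s \<and> a + b = height W}"
            then obtain a b where ab: "u \<in> flag a b" "a \<le> r" "b \<le> s" "a + b = height W" by auto
            then have "a < r \<or> b < s" using 3 rs by linarith
            then show "cinner u v = 0"
            proof
              assume "a < r"
              then have "flag a b \<subseteq> flag (r - 1) s" using ab by (intro flag_mono) linarith+
              then have "u \<in> flag (r - 1) s" using ab by blast
              then show ?thesis using v \<open>a < r\<close> by (auto simp: flag_top_def perp_def)
            next
              assume "b < s"
              then have "flag a b \<subseteq> flag r (s - 1)" using ab by (intro flag_mono) linarith+
              then have "u \<in> flag r (s - 1)" using ab by blast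
              then show ?thesis using v \<open>b < s\<close> by (auto simp: flag_top_def perp_def)
            qed
          qed
          then have "w W = 0" using cinner_family(1)[OF \<W> w(1) W, of "w W"] w W by simp
          then show ?thesis by (simp add: vec.span_zero)
        qed
      qed
      then show "v \<in> vec.span (\<Union> {W. simple W \<and> height W = k})"
        unfolding w(2) by (rule vec.span_sum)
    qed
    then have "\<Union> {flag_top r s | r s. r \<le> i \<and> s \<le> j \<and> r + s = k} \<subseteq>
        flag i j \<inter> vec.span (\<Union> {W. simple W \<and> height W = k})"
      by blast
    then have "vec.span (\<Union> {flag_top r s | r s. r \<le> i \<and> s \<le> j \<and> r + s = k}) \<subseteq>
        flag i j \<inter> vec.span (\<Union> {W. simple W \<and> height W = k})"
      by (rule vec.span_minimal) (intro vec.subspace_inter subspace_flag vec.subspace_span)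
    then show "v \<in> flag i j \<inter> vec.span (\<Union> {W. simple W \<and> height W = k})"
      if "v \<in> vec.span (\<Union> {flag_top r s | r s. r \<le> i \<and> s \<le> j \<and> r + s = k})" for v
      using that by blast
  qed
qed

end

section \<open>Flags as intersections of spans\<close>

context dual_idempotent_systems
begin

text \<open>Distinct \<open>F h\<close> annihilate each other, which gives one inclusion.
  Conversely, \<open>v\<close> is the sum of its components, of which only those up to
  \<open>i\<close> survive.\<close>

lemma span_components_F:
  "i \<le> D \<Longrightarrow> vec.span (\<Union>h\<in>{0..i}. mimage (F h) UNIV) = {v. \<forall>h\<le>D. i < h \<longrightarrow> F h *v v = 0}"
proof (intro equalityI)
  assume i: "i \<le> D"
  show "vec.span (\<Union>h\<in>{0..i}. mimage (F h) UNIV) \<subseteq> {v. \<forall>h\<le>D. i < h \<longrightarrow> F h *v v = 0}"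
  proof (rule vec.span_minimal)
    show "(\<Union>h\<in>{0..i}. mimage (F h) UNIV) \<subseteq> {v. \<forall>h\<le>D. i < h \<longrightarrow> F h *v v = 0}"
      using i by (auto simp: mimage_def F_mult)
    show "vec.subspace {v. \<forall>h\<le>D. i < h \<longrightarrow> F h *v v = 0}"
      by (auto simp: vec.subspace_def vec.add vec.scale)
  qed
  show "{v. \<forall>h\<le>D. i < h \<longrightarrow> F h *v v = 0} \<subseteq> vec.span (\<Union>h\<in>{0..i}. mimage (F h) UNIV)"
  proof
    fix v assume v: "v \<in> {v. \<forall>h\<le>D. i < h \<longrightarrow> F h *v v = 0}"
    have "F h *v v \<in> vec.span (\<Union>h\<in>{0..i}. mimage (F h) UNIV)" if "h \<in> {..D}" for h
    proof (cases "i < h")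
      case True
      then have "F h *v v = 0" using v that by simp
      then show ?thesis by (simp add: vec.span_zero)
    next
      case False
      then show ?thesis by (intro vec.span_base UN_I[of h]) (auto simp: mimage_def)
    qed
    then have "(\<Sum>h\<le>D. F h *v v) \<in> vec.span (\<Union>h\<in>{0..i}. mimage (F h) UNIV)"
      by (rule vec.span_sum)
    then show "v \<in> vec.span (\<Union>h\<in>{0..i}. mimage (F h) UNIV)" by (simp add: F_sum)
  qed
qed

end

context dual_idempotent_systems
begin

interpretation dual: dual_idempotent_systems B A F E \<phi> \<theta> D
  by (rule dual)

lemma span_components_Int:
  assumes "i \<le> D" "j \<le> D"
  shows "vec.span (\<Union>h\<in>{0..i}. mimage (F h) UNIV) \<inter> vec.span (\<Union>h\<in>{0..j}. mimage (E h) UNIV) = flag i j"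
  unfolding span_components_F[OF assms(1)] dual.span_components_F[OF assms(2)] flag_def by blast

end

section \<open>Complex matrices\<close>

lemma relpowp_sym:
  assumes "\<And>u v. r u v \<Longrightarrow> r v u" "(r ^^ n) u v"
  shows "(r ^^ n) v u"
  using assms(2)
proof (induction n arbitrary: v)
  case (Suc n)
  then obtain w where "(r ^^ n) u w" "r w v" by (auto simp: relcompp_apply)
  then show ?case using Suc.IH assms(1) relpowp_Suc_I2[of r v w n u] by auto
qed simp

lemma mscale_component [simp]: "mscale c M $ i $ j = c * M $ i $ j"
  by (simp add: mscale_def)

lemma hadamard_component [simp]: "hadamard M N $ i $ j = M $ i $ j * N $ i $ j"
  by (simp add: hadamard_def)

lemma mscale_mult_vec: "mscale c M *v v = c *s (M *v v)"
  by (simp add: vec_eq_iff matrix_vector_mult_def sum_distrib_left mult.assoc)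

lemma mscale_mult_left: "mscale c M ** N = mscale c (M ** N)"
  by (simp add: vec_eq_iff matrix_matrix_mult_def sum_distrib_left mult.assoc)

lemma mscale_mult_right: "M ** mscale c N = mscale c (M ** N)"
  by (simp add: vec_eq_iff matrix_matrix_mult_def sum_distrib_left mult.left_commute)

lemma sum_matrix_vec_mult: "(\<Sum>i\<in>I. M i :: complex^'n^'m) *v v = (\<Sum>i\<in>I. M i *v v)"
  by (induction I rule: infinite_finite_induct) (simp_all add: matrix_vector_mult_add_rdistrib)

definition conj_transpose :: "complex^'n^'n \<Rightarrow> complex^'n^'n" where
  "conj_transpose M = (\<chi> u v. cnj (M $ v $ u))"

lemma conj_transpose_conj_transpose [simp]: "conj_transpose (conj_transpose M) = M"
  by (simp add: conj_transpose_def vec_eq_iff)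

lemma conj_transpose_0_iff [simp]: "conj_transpose M = 0 \<longleftrightarrow> M = 0"
  by (auto simp: conj_transpose_def vec_eq_iff)

lemma conj_transpose_mult: "conj_transpose (M ** N) = conj_transpose N ** conj_transpose M"
  by (simp add: conj_transpose_def vec_eq_iff matrix_matrix_mult_def mult.commute)

lemma cinner_conj_transpose: "cinner (M *v u) v = cinner u (conj_transpose M *v v)"
proof -
  have "cinner (M *v u) v = (\<Sum>y\<in>UNIV. \<Sum>z\<in>UNIV. M $ y $ z * u $ z * cnj (v $ y))"
    by (simp add: cinner_def matrix_vector_mult_def sum_distrib_right)
  also have "\<dots> = (\<Sum>z\<in>UNIV. \<Sum>y\<in>UNIV. M $ y $ z * u $ z * cnj (v $ y))"
    by (rule sum.swap)
  also have "\<dots> = cinner u (conj_transpose M *v v)"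
    by (simp add: cinner_def matrix_vector_mult_def conj_transpose_def sum_distrib_left mult_ac)
  finally show ?thesis .
qed

text \<open>The squared norm of \<open>M *v v\<close> is the inner product of \<open>v\<close> with
  \<open>(conj_transpose M ** M) *v v\<close>.\<close>

lemma conj_transpose_mult_self_eq_0:
  assumes "conj_transpose M ** M = 0"
  shows "M = 0"
proof -
  have "M *v v = 0" for v
    using cinner_conj_transpose[of M v "M *v v"] assms by (simp add: matrix_vector_mul_assoc)
  then show ?thesis by (simp add: matrix_eq)
qed

definition diag_matrix :: "('n \<Rightarrow> complex) \<Rightarrow> complex^'n^'n" where
  "diag_matrix g = (\<chi> y z. if y = z then g y else 0)"

lemma diag_matrix_component: "diag_matrix g $ y $ z = (if y = z then g y else 0)"
  by (simp add: diag_matrix_def)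

lemma diag_matrix_mult: "diag_matrix g ** M = (\<chi> y z. g y * M $ y $ z)"
  by (simp add: vec_eq_iff matrix_matrix_mult_def diag_matrix_component if_distrib if_distribR cong: if_cong)

lemma mult_diag_matrix: "M ** diag_matrix g = (\<chi> y z. M $ y $ z * g z)"
  by (simp add: vec_eq_iff matrix_matrix_mult_def diag_matrix_component if_distrib if_distribR cong: if_cong)

lemma diag_matrix_mult_diag: "diag_matrix g ** diag_matrix h = diag_matrix (\<lambda>y. g y * h y)"
  by (simp add: vec_eq_iff diag_matrix_mult) (simp add: diag_matrix_component)

lemma diag_matrix_vec_component [simp]: "(diag_matrix g *v v) $ y = g y * v $ y"
  by (simp add: matrix_vector_mult_def diag_matrix_component if_distrib if_distribR cong: if_cong)

lemma Estar_diag: "Estar adj x i = diag_matrix (\<lambda>y. if gdist adj x y = i then 1 else 0)"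
  by (auto simp: Estar_def diag_matrix_def vec_eq_iff)

lemma Astar_diag: "Astar E x = diag_matrix (\<lambda>y. of_nat CARD('a) * E 1 $ x $ y)" for x :: "'a::finite"
  by (simp only: Astar_def diag_matrix_def)

lemma gen_alg_0: "0 \<in> gen_alg P Q"
  using gen_alg.scale[OF gen_alg.one, of 0 P Q] by (simp add: mscale_def vec_eq_iff zero_vec_def)

lemma gen_alg_diff: "M \<in> gen_alg P Q \<Longrightarrow> N \<in> gen_alg P Q \<Longrightarrow> M - N \<in> gen_alg P Q"
  using gen_alg.add[OF _ gen_alg.scale[of N P Q "-1"], of M]
  by (simp add: vec_eq_iff mscale_def minus_vec_def plus_vec_def)

lemma gen_alg_sum: "(\<And>i. i \<in> I \<Longrightarrow> M i \<in> gen_alg P Q) \<Longrightarrow> (\<Sum>i\<in>I. M i) \<in> gen_alg P Q"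
  by (induction I rule: infinite_finite_induct) (auto intro: gen_alg_0 gen_alg.add)

text \<open>Reduces the module condition over the whole algebra to its two generators.\<close>

lemma gen_alg_invariant_iff:
  assumes W: "vec.subspace W"
  shows "(\<forall>M\<in>gen_alg P Q. \<forall>v\<in>W. M *v v \<in> W) \<longleftrightarrow> (\<forall>v\<in>W. P *v v \<in> W) \<and> (\<forall>v\<in>W. Q *v v \<in> W)"
proof safe
  fix M v assume P: "\<forall>v\<in>W. P *v v \<in> W" and Q: "\<forall>v\<in>W. Q *v v \<in> W" and M: "M \<in> gen_alg P Q" and "v \<in> W"
  from M \<open>v \<in> W\<close> show "M *v v \<in> W"
  proof (induction arbitrary: v)
    case (add M N)
    then show ?case using W by (simp add: matrix_vector_mult_add_rdistrib vec.subspace_add)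
  next
    case (scale M c)
    then show ?case using W by (simp add: mscale_mult_vec vec.subspace_scale)
  next
    case (mult M N)
    then show ?case by (simp flip: matrix_vector_mul_assoc)
  qed (use P Q in auto)
qed (auto intro: gen_alg.intros)

section \<open>The Bose-Mesner algebra of a distance-regular graph\<close>

locale distance_regular_graph =
  fixes adj :: "'a::finite \<Rightarrow> 'a \<Rightarrow> bool"
  assumes distance_regular: "distance_regular adj"
begin

abbreviation \<delta> :: "'a \<Rightarrow> 'a \<Rightarrow> nat" where "\<delta> \<equiv> gdist adj"
abbreviation D :: nat where "D \<equiv> diam adj"

lemma adj_sym: "adj u v \<Longrightarrow> adj v u" and connected: "\<exists>n. (adj ^^ n) u v"
  using distance_regular by (auto simp: distance_regular_def simple_connected_graph_def)

lemma relpowp_dist: "(adj ^^ \<delta> u v) u v"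
  unfolding gdist_def using connected by (rule LeastI_ex)

lemma dist_le: "(adj ^^ n) u v \<Longrightarrow> \<delta> u v \<le> n"
  unfolding gdist_def by (rule Least_le)

lemma dist_self [simp]: "\<delta> u u = 0"
  using dist_le[of 0 u u] by simp

lemma dist_commute: "\<delta> u v = \<delta> v u"
  using dist_le relpowp_dist relpowp_sym[of adj, OF adj_sym] by (metis le_antisym)

lemma dist_triangle: "\<delta> u w \<le> \<delta> u v + \<delta> v w"
proof (rule dist_le)
  show "(adj ^^ (\<delta> u v + \<delta> v w)) u w"
    using relpowp_dist[of u v] relpowp_dist[of v w] by (auto simp: relpowp_add)
qed

lemma dist_eq_0_iff [simp]: "\<delta> u v = 0 \<longleftrightarrow> u = v"
  using relpowp_dist[of u v] by auto

lemma dist_Suc_predecessor: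
  assumes "\<delta> u v = Suc n"
  obtains w where "\<delta> u w = 1" "\<delta> w v = n"
proof -
  from relpowp_dist[of u v] assms obtain w where w: "adj u w" "(adj ^^ n) w v"
    by (metis relpowp_Suc_D2)
  have "\<delta> u w \<le> 1" "\<delta> w v \<le> n" using w dist_le[of 1 u w] dist_le[of n w v] by auto
  moreover have "Suc n \<le> \<delta> u w + \<delta> w v" using dist_triangle[of u v w] assms by simp
  ultimately have "\<delta> u w = 1" "\<delta> w v = n" by linarith+
  then show ?thesis by (rule that)
qed

lemma dist_le_D: "\<delta> u v \<le> D"
proof -
  have "finite {\<delta> u v | u v. True}"
    by (rule finite_subset[of _ "range (\<lambda>(u, v). \<delta> u v)"]) auto
  then show ?thesis unfolding diam_def by (intro Max_ge) auto
qed

lemma card_dist_eq: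
  "\<delta> u v = \<delta> u' v' \<Longrightarrow>
   card {z. \<delta> u z = i \<and> \<delta> v z = j} = card {z. \<delta> u' z = i \<and> \<delta> v' z = j}"
  using distance_regular[unfolded distance_regular_def, THEN conjunct2, rule_format, of u v "\<delta> u v" u' v' i j]
  by simp

text \<open>Walking back along a geodesic between two vertices at distance \<open>D\<close> gives a
  vertex at each distance from one particular \<open>u\<close>. Distance-regularity carries this to
  an arbitrary \<open>x\<close>.\<close>

lemma exists_at_dist:
  assumes "i \<le> D"
  obtains y where "\<delta> x y = i"
proof -
  have "finite {\<delta> u v | u v. True}"
    by (rule finite_subset[of _ "range (\<lambda>(u, v). \<delta> u v)"]) auto
  then have "D \<in> {\<delta> u v | u v. True}" unfolding diam_def by (intro Max_in) auto
  then obtain u v where uv: "\<delta> u v = D" by auto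
  have "\<exists>w. \<delta> u w = D - k" if "k \<le> D" for k
    using that
  proof (induction k)
    case 0
    then show ?case using uv by auto
  next
    case (Suc k)
    then obtain w where "\<delta> u w = Suc (D - Suc k)" by (auto simp: Suc_diff_Suc)
    then obtain w' where "\<delta> w' u = D - Suc k"
      using dist_Suc_predecessor[of w u] by (metis dist_commute)
    then show ?case by (metis dist_commute)
  qed
  from this[of "D - i"] assms obtain w where w: "\<delta> u w = i" by auto
  \<comment> \<open>With equal vertices and equal indices the intersection number counts the sphere
    of radius \<open>i\<close>.\<close>
  have "card {z. \<delta> u z = i \<and> \<delta> u z = i} = card {z. \<delta> x z = i \<and> \<delta> x z = i}"
    by (rule card_dist_eq) simp
  moreover have "card {z. \<delta> u z = i \<and> \<delta> u z = i} \<noteq> 0" using w by auto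
  ultimately have "{z. \<delta> x z = i \<and> \<delta> x z = i} \<noteq> {}" by (metis card.empty)
  then show ?thesis using that by auto
qed

text \<open>By \<open>bose_mesner_iff\<close> this is membership in the Bose-Mesner algebra, in a
  form that can be checked entry by entry.\<close>

definition dist_invariant :: "complex^'a^'a \<Rightarrow> bool" where
  "dist_invariant M \<longleftrightarrow> (\<forall>u v u' v'. \<delta> u v = \<delta> u' v' \<longrightarrow> M $ u $ v = M $ u' $ v')"

lemma dist_invariantD: "dist_invariant M \<Longrightarrow> \<delta> u v = \<delta> u' v' \<Longrightarrow> M $ u $ v = M $ u' $ v'"
  unfolding dist_invariant_def by blast

lemma dist_invariant_distmat: "dist_invariant (distmat adj i)"
  by (simp add: dist_invariant_def distmat_def)

lemma dist_invariant_sum: "(\<And>i. i \<in> I \<Longrightarrow> dist_invariant (M i)) \<Longrightarrow> dist_invariant (\<Sum>i\<in>I. M i)"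
  unfolding dist_invariant_def sum_component by (meson sum.cong)

lemma dist_invariant_diff:
  assumes "dist_invariant M" "dist_invariant N"
  shows "dist_invariant (M - N)"
  unfolding dist_invariant_def vector_minus_component
proof (intro allI impI)
  fix u v u' v' assume "\<delta> u v = \<delta> u' v'"
  from assms[THEN dist_invariantD, OF this] show "M $ u $ v - N $ u $ v = M $ u' $ v' - N $ u' $ v'"
    by simp
qed

lemma dist_invariant_mscale: "dist_invariant M \<Longrightarrow> dist_invariant (mscale c M)"
  unfolding dist_invariant_def mscale_component by metis

lemma dist_invariant_expand:
  assumes M: "dist_invariant M"
  obtains m where "M = (\<Sum>i\<le>D. mscale (m i) (distmat adj i))"
proof -
  fix x :: 'a
  define m where "m i = M $ x $ (SOME y. \<delta> x y = i)" for i
  have m: "M $ u $ v = m (\<delta> u v)" for u v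
  proof -
    obtain y where "\<delta> x y = \<delta> u v" using exists_at_dist[OF dist_le_D] .
    then have "\<delta> x (SOME y. \<delta> x y = \<delta> u v) = \<delta> u v" by (rule someI)
    then show ?thesis unfolding m_def by (intro dist_invariantD[OF M]) simp
  qed
  have "M = (\<Sum>i\<le>D. mscale (m i) (distmat adj i))"
    by (simp add: vec_eq_iff m distmat_def if_distrib dist_le_D cong: if_cong)
  then show ?thesis by (rule that)
qed

lemma bose_mesner_iff: "M \<in> bose_mesner adj \<longleftrightarrow> dist_invariant M"
proof
  assume "M \<in> bose_mesner adj"
  then obtain \<F> c where \<F>: "\<F> \<subseteq> {distmat adj i | i. i \<le> D}" and M: "M = (\<Sum>N\<in>\<F>. mscale (c N) N)"
    by (auto simp: bose_mesner_def mspan_def)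
  show "dist_invariant M" unfolding M
    by (intro dist_invariant_sum dist_invariant_mscale) (use \<F> dist_invariant_distmat in auto)
next
  assume "dist_invariant M"
  then obtain m where m: "M = (\<Sum>i\<le>D. mscale (m i) (distmat adj i))" by (rule dist_invariant_expand)
  \<comment> \<open>Every distance up to \<open>D\<close> occurs, so the distance matrices are
    distinct and the sum over indices becomes a sum over a set of matrices, as \<open>mspan\<close>
    asks.\<close>
  have inj: "inj_on (distmat adj) {..D}"
  proof (rule inj_onI)
    fix i j assume ij: "i \<in> {..D}" "j \<in> {..D}" "distmat adj i = distmat adj j"
    fix x :: 'a
    obtain y where "\<delta> x y = i" using exists_at_dist ij by auto
    then have "distmat adj i $ x $ y = 1" by (simp add: distmat_def)
    then have "distmat adj j $ x $ y = 1" using ij by simp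
    then show "i = j" using \<open>\<delta> x y = i\<close> by (simp add: distmat_def split: if_splits)
  qed
  have "M = (\<Sum>N\<in>distmat adj ` {..D}. mscale (m (the_inv_into {..D} (distmat adj) N)) N)"
    unfolding m by (simp add: sum.reindex[OF inj] the_inv_into_f_f[OF inj])
  moreover have "finite (distmat adj ` {..D})" "distmat adj ` {..D} \<subseteq> {distmat adj i | i. i \<le> D}"
    by auto
  ultimately show "M \<in> bose_mesner adj" unfolding bose_mesner_def mspan_def mem_Collect_eq
    by (intro exI conjI)
qed

text \<open>Grouping the middle vertices \<open>z\<close> by their distances to \<open>u\<close> and
  \<open>v\<close> expresses each entry through intersection numbers.\<close>

lemma dist_invariant_mult:
  assumes M: "dist_invariant M" and N: "dist_invariant N"
  shows "dist_invariant (M ** N)"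
proof -
  obtain m where m: "M = (\<Sum>i\<le>D. mscale (m i) (distmat adj i))" using dist_invariant_expand[OF M] .
  obtain n where n: "N = (\<Sum>i\<le>D. mscale (n i) (distmat adj i))" using dist_invariant_expand[OF N] .
  have Mc: "M $ u $ v = m (\<delta> u v)" and Nc: "N $ u $ v = n (\<delta> u v)" for u v
    by (simp_all add: m n distmat_def if_distrib dist_le_D cong: if_cong)
  have entry: "(M ** N) $ u $ v = (\<Sum>p\<in>{..D} \<times> {..D}. of_nat (card {z. \<delta> u z = fst p \<and> \<delta> v z = snd p}) * (m (fst p) * n (snd p)))"
    for u v
  proof -
    have "(M ** N) $ u $ v = (\<Sum>z\<in>UNIV. m (\<delta> u z) * n (\<delta> v z))"
      by (simp add: matrix_matrix_mult_def Mc Nc dist_commute[of v])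
    also have "\<dots> = (\<Sum>p\<in>{..D} \<times> {..D}. \<Sum>z | z \<in> UNIV \<and> (\<delta> u z, \<delta> v z) = p. m (\<delta> u z) * n (\<delta> v z))"
      by (rule sum.group[symmetric]) (auto simp: dist_le_D)
    also have "\<dots> = (\<Sum>p\<in>{..D} \<times> {..D}. \<Sum>z | \<delta> u z = fst p \<and> \<delta> v z = snd p. m (fst p) * n (snd p))"
      by (intro sum.cong) auto
    finally show ?thesis by simp
  qed
  show ?thesis
    unfolding dist_invariant_def
  proof (intro allI impI)
    fix u v u' v' assume "\<delta> u v = \<delta> u' v'"
    from card_dist_eq[OF this] show "(M ** N) $ u $ v = (M ** N) $ u' $ v'"
      unfolding entry by (intro sum.cong refl) simp
  qed
qed

lemma dist_invariant_sym: "dist_invariant M \<Longrightarrow> M $ u $ v = M $ v $ u"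
  by (rule dist_invariantD[OF _ dist_commute])

lemma dist_invariant_transpose: "dist_invariant M \<Longrightarrow> transpose M = M"
  by (simp add: transpose_def vec_eq_iff) (metis dist_invariant_sym)

text \<open>Both factors and their product are symmetric.\<close>

lemma dist_invariant_mult_commute:
  assumes "dist_invariant M" "dist_invariant N"
  shows "M ** N = N ** M"
  using dist_invariant_transpose[OF dist_invariant_mult[OF assms]]
  by (simp add: matrix_transpose_mul dist_invariant_transpose assms)

lemma dist_invariant_conj_transpose:
  assumes M: "dist_invariant M"
  shows "dist_invariant (conj_transpose M)"
  unfolding dist_invariant_def
proof (intro allI impI)
  fix u v u' v' assume "\<delta> u v = \<delta> u' v'"
  then have "M $ v $ u = M $ v' $ u'"
    using dist_commute[of u v] dist_commute[of u' v'] by (intro dist_invariantD[OF M]) simp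
  then show "conj_transpose M $ u $ v = conj_transpose M $ u' $ v'" by (simp add: conj_transpose_def)
qed

text \<open>Every distance occurs from \<open>x\<close>, so column \<open>x\<close> already shows
  all entries. Linear relations between such matrices can thus be tested on single vectors.\<close>

lemma dist_invariant_eq_0:
  assumes M: "dist_invariant M" and 0: "M *v axis x 1 = 0"
  shows "M = 0"
proof -
  have "M $ u $ v = 0" for u v
  proof -
    obtain y where y: "\<delta> x y = \<delta> u v" using exists_at_dist[OF dist_le_D] .
    then have "M $ u $ v = M $ y $ x" by (intro dist_invariantD[OF M]) (simp add: dist_commute)
    also have "\<dots> = (M *v axis x 1) $ y"
      by (simp add: matrix_vector_mult_def axis_def if_distrib cong: if_cong)
    finally show ?thesis using 0 by simp
  qed
  then show ?thesis by (simp add: vec_eq_iff)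
qed

text \<open>The product of the first and the \<open>(i - 1)\<close>-st distance matrix is a
  combination of distance matrices up to index \<open>i\<close>. Its coefficient at \<open>i\<close>
  is nonzero because of the geodesics, so \<open>distmat adj i\<close> can be solved for.\<close>

lemma distmat_in_gen_alg:
  assumes "i \<le> D"
  shows "distmat adj i \<in> gen_alg (distmat adj 1) Q"
  using assms
proof (induction i rule: less_induct)
  case (less i)
  show ?case
  proof (cases i)
    case 0
    then have "distmat adj i = mat 1" by (simp add: distmat_def mat_def vec_eq_iff)
    then show ?thesis by (simp add: gen_alg.one)
  next
    case (Suc k)
    let ?P = "distmat adj 1 ** distmat adj k"
    have kD: "k \<le> D" using Suc less.prems by simp
    have entry: "?P $ u $ v = of_nat (card {z. \<delta> u z = 1 \<and> \<delta> z v = k})" for u v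
    proof -
      have "?P $ u $ v = (\<Sum>z\<in>UNIV. if \<delta> u z = 1 \<and> \<delta> z v = k then 1 else 0)"
        unfolding matrix_matrix_mult_def distmat_def vec_lambda_beta by (intro sum.cong) auto
      then show ?thesis by (simp add: sum.If_cases)
    qed
    have "dist_invariant ?P" by (intro dist_invariant_mult dist_invariant_distmat)
    then obtain m where m: "?P = (\<Sum>h\<le>D. mscale (m h) (distmat adj h))" by (rule dist_invariant_expand)
    have mc: "?P $ u $ v = m (\<delta> u v)" for u v
      unfolding m by (simp add: distmat_def if_distrib dist_le_D cong: if_cong)
    have m0: "m h = 0" if h: "h \<le> D" "i < h" for h
    proof -
      fix x :: 'a
      obtain y where y: "\<delta> x y = h" using exists_at_dist[OF h(1)] .
      have "{z. \<delta> x z = 1 \<and> \<delta> z y = k} = {}"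
      proof (intro equals0I, elim CollectE conjE)
        fix z assume "\<delta> x z = 1" "\<delta> z y = k"
        then show False using dist_triangle[of x y z] h y Suc by simp
      qed
      then show ?thesis using mc[of x y] entry[of x y] y by simp
    qed
    have mi: "m i \<noteq> 0"
    proof -
      fix x :: 'a
      obtain y where y: "\<delta> x y = i" using exists_at_dist[OF less.prems] .
      then obtain w where "\<delta> x w = 1" "\<delta> w y = k" using dist_Suc_predecessor Suc by metis
      then have "{z. \<delta> x z = 1 \<and> \<delta> z y = k} \<noteq> {}" by auto
      then show ?thesis using mc[of x y] entry[of x y] y by simp
    qed
    have "?P = (\<Sum>h\<le>i. mscale (m h) (distmat adj h))"
      unfolding m by (rule sum.mono_neutral_right) (use less.prems m0 in \<open>auto simp: vec_eq_iff\<close>)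
    also have "\<dots> = (\<Sum>h<i. mscale (m h) (distmat adj h)) + mscale (m i) (distmat adj i)"
      by (simp add: lessThan_Suc_atMost[symmetric])
    finally have "mscale (m i) (distmat adj i) = ?P - (\<Sum>h<i. mscale (m h) (distmat adj h))" by simp
    moreover have "\<dots> \<in> gen_alg (distmat adj 1) Q"
      by (intro gen_alg_diff gen_alg_sum gen_alg.mult gen_alg.gen1 gen_alg.scale less.IH)
        (use Suc less.prems in auto)
    ultimately have "mscale (1 / m i) (mscale (m i) (distmat adj i)) \<in> gen_alg (distmat adj 1) Q"
      by (simp add: gen_alg.scale)
    moreover have "mscale (1 / m i) (mscale (m i) (distmat adj i)) = distmat adj i"
      using mi by (simp add: vec_eq_iff)
    ultimately show ?thesis by simp
  qed
qed

lemma dist_invariant_in_gen_alg: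
  assumes "dist_invariant M"
  shows "M \<in> gen_alg (distmat adj 1) Q"
proof -
  obtain m where m: "M = (\<Sum>i\<le>D. mscale (m i) (distmat adj i))" using dist_invariant_expand[OF assms] .
  show ?thesis unfolding m by (intro gen_alg_sum gen_alg.scale distmat_in_gen_alg) simp
qed

text \<open>Distances of adjacent vertices to \<open>x\<close> differ by at most one.\<close>

lemma Estar_distmat_Estar:
  assumes "Suc i < j \<or> Suc j < i"
  shows "Estar adj x i ** distmat adj 1 ** Estar adj x j = 0"
proof -
  have "(if \<delta> x y = i then 1 else 0) * distmat adj 1 $ y $ z * (if \<delta> x z = j then 1 else 0) = 0" for y z
    using dist_triangle[of x y z] dist_triangle[of x z y] assms dist_commute[of y z]
    by (auto simp: distmat_def)
  then show ?thesis
    by (simp add: Estar_diag diag_matrix_mult mult_diag_matrix vec_eq_iff)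
qed

end

section \<open>The Q-polynomial structure\<close>

locale Q_polynomial_graph = distance_regular_graph adj
  for adj :: "'a::finite \<Rightarrow> 'a \<Rightarrow> bool" +
  fixes E :: "nat \<Rightarrow> complex^'a^'a" and x :: 'a
  assumes Q_polynomial: "Q_polynomial adj E"
    and D_pos: "0 < D"
begin

lemma E_bij: "bij_betw E {0..D} {P. primitive_idempotent adj P}"
  using Q_polynomial by (simp add: Q_polynomial_def idempotent_ordering_def)

lemma E_primitive: "i \<le> D \<Longrightarrow> primitive_idempotent adj (E i)"
  using bij_betwE[OF E_bij] by auto

lemma E_dist_invariant: "i \<le> D \<Longrightarrow> dist_invariant (E i)"
  using E_primitive by (auto simp: primitive_idempotent_def bose_mesner_iff)

lemma E_idem: "i \<le> D \<Longrightarrow> E i ** E i = E i"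
  using E_primitive by (auto simp: primitive_idempotent_def)

lemma E_nonzero: "i \<le> D \<Longrightarrow> E i \<noteq> 0"
  using E_primitive by (auto simp: primitive_idempotent_def)

lemma E_inj: "i \<le> D \<Longrightarrow> j \<le> D \<Longrightarrow> E i = E j \<Longrightarrow> i = j"
  using bij_betw_imp_inj_on[OF E_bij] by (auto dest: inj_onD)

lemma primitive_minimal:
  "primitive_idempotent adj P \<Longrightarrow> dist_invariant M \<Longrightarrow> M ** M = M \<Longrightarrow> M ** P = M \<Longrightarrow> M = 0 \<or> M = P"
  by (auto simp: primitive_idempotent_def bose_mesner_iff)

text \<open>The product of two commuting idempotents is an idempotent below both, so by minimality
  it is zero or equal to both.\<close>

lemma E_orthogonal:
  assumes i: "i \<le> D" and j: "j \<le> D" and ne: "i \<noteq> j"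
  shows "E i ** E j = 0"
proof (rule ccontr)
  assume nz: "E i ** E j \<noteq> 0"
  have comm: "E i ** E j = E j ** E i"
    using i j by (intro dist_invariant_mult_commute E_dist_invariant)
  have inv: "dist_invariant (E i ** E j)"
    using i j by (intro dist_invariant_mult E_dist_invariant)
  have 1: "(E i ** E j) ** E j = E i ** E j"
    by (simp add: matrix_mul_assoc[symmetric] E_idem[OF j])
  have 2: "(E i ** E j) ** E i = E i ** E j"
    unfolding comm by (simp add: matrix_mul_assoc[symmetric] E_idem[OF i])
  have 3: "(E i ** E j) ** (E i ** E j) = E i ** E j"
    by (simp only: matrix_mul_assoc 1 2)
  have "E i ** E j = E j" using primitive_minimal[OF E_primitive[OF j] inv 3 1] nz by simp
  moreover have "E i ** E j = E i" using primitive_minimal[OF E_primitive[OF i] inv 3 2] nz by simp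
  ultimately show False using E_inj[OF i j] ne by simp
qed

lemma E_comb_mult:
  assumes "k \<le> D"
  shows "(\<Sum>i\<le>D. mscale (c i) (E i)) ** E k = mscale (c k) (E k)"
proof -
  have "((\<Sum>i\<le>D. mscale (c i) (E i)) ** E k) *v v = mscale (c k) (E k) *v v" for v
  proof -
    have "((\<Sum>i\<le>D. mscale (c i) (E i)) ** E k) *v v = (\<Sum>i\<le>D. c i *s ((E i ** E k) *v v))"
      by (simp add: matrix_vector_mul_assoc[symmetric] sum_matrix_vec_mult mscale_mult_vec)
    also have "\<dots> = (\<Sum>i\<le>D. if i = k then c k *s (E k *v v) else 0)"
      using assms by (intro sum.cong) (auto simp: E_orthogonal E_idem)
    also have "\<dots> = mscale (c k) (E k) *v v" using assms by (simp add: mscale_mult_vec)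
    finally show ?thesis .
  qed
  then show ?thesis by (simp add: matrix_eq)
qed

lemma E_comb_eq_0:
  assumes "(\<Sum>i\<le>D. mscale (c i) (E i)) = 0" "k \<le> D"
  shows "c k = 0"
proof -
  have "mscale (c k) (E k) = 0" using E_comb_mult[OF assms(2), of c] assms(1) by simp
  moreover obtain u v where "E k $ u $ v \<noteq> 0" using E_nonzero[OF assms(2)] by (auto simp: vec_eq_iff)
  ultimately show ?thesis by (auto simp: vec_eq_iff)
qed

lemma E_comb_invariant: "dist_invariant (\<Sum>i\<le>D. mscale (c i) (E i))"
  by (intro dist_invariant_sum dist_invariant_mscale E_dist_invariant) simp

text \<open>Passing to column \<open>x\<close> is injective on the algebra. The \<open>D + 1\<close>
  independent columns of the \<open>E i\<close> lie in the span of the \<open>D + 1\<close> columns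
  of the distance matrices, so they span it.\<close>

lemma E_spans:
  assumes M: "dist_invariant M"
  obtains c where "M = (\<Sum>i\<le>D. mscale (c i) (E i))"
proof -
  define e where "e i = E i *v axis x 1" for i
  define a where "a i = distmat adj i *v axis x 1" for i
  have comb: "(\<Sum>i\<le>D. mscale (c i) (E i)) *v axis x 1 = (\<Sum>i\<le>D. c i *s e i)" for c
    by (simp add: sum_matrix_vec_mult mscale_mult_vec e_def)
  have zero: "c k = 0" if "(\<Sum>i\<le>D. c i *s e i) = 0" "k \<le> D" for c k
    using that E_comb_eq_0 dist_invariant_eq_0[OF E_comb_invariant, of c x] comb by simp
  have inj: "inj_on e {..D}"
  proof (rule inj_onI)
    fix i j assume ij: "i \<in> {..D}" "j \<in> {..D}" "e i = e j"
    show "i = j"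
    proof (rule ccontr)
      assume "i \<noteq> j"
      define c where "c k = (if k = i then 1 else if k = j then -1 else 0 :: complex)" for k
      have "(\<Sum>k\<le>D. c k *s e k) = (\<Sum>k\<in>{i, j}. c k *s e k)"
        using ij by (intro sum.mono_neutral_right) (auto simp: c_def)
      also have "\<dots> = 0" using ij(3) \<open>i \<noteq> j\<close> by (simp add: c_def)
      finally have "c i = 0" using zero ij by blast
      then show False by (simp add: c_def)
    qed
  qed
  have indep: "vec.independent (e ` {..D})"
    unfolding vec.independent_explicit
  proof (intro conjI allI impI ballI)
    fix c v assume "(\<Sum>v\<in>e ` {..D}. c v *s v) = 0" "v \<in> e ` {..D}"
    then show "c v = 0" using zero[of "c \<circ> e"] by (auto simp: sum.reindex[OF inj])
  qed simp
  have expand: "N *v axis x 1 \<in> vec.span (a ` {..D})" if N: "dist_invariant N" for N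
  proof -
    obtain m where m: "N = (\<Sum>i\<le>D. mscale (m i) (distmat adj i))" using dist_invariant_expand[OF N] .
    have "N *v axis x 1 = (\<Sum>i\<le>D. m i *s a i)"
      unfolding m by (simp add: sum_matrix_vec_mult mscale_mult_vec a_def)
    also have "\<dots> \<in> vec.span (a ` {..D})"
      by (intro vec.span_sum vec.span_scale vec.span_base) simp
    finally show ?thesis .
  qed
  have "vec.dim (vec.span (a ` {..D})) \<le> card (a ` {..D})"
    by (simp add: vec.dim_le_card')
  also have "\<dots> \<le> card (e ` {..D})"
    using card_image_le[of "{..D}" a] by (simp add: card_image[OF inj])
  finally have dim: "vec.dim (vec.span (a ` {..D})) \<le> card (e ` {..D})" .
  have "vec.span (a ` {..D}) \<subseteq> vec.span (e ` {..D})"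
    by (rule vec.card_ge_dim_independent[OF _ indep dim]) (auto simp: e_def intro!: expand E_dist_invariant)
  then have "M *v axis x 1 \<in> vec.span (e ` {..D})" using expand[OF M] by blast
  then obtain c where c: "M *v axis x 1 = (\<Sum>v\<in>e ` {..D}. c v *s v)"
    by (auto simp: vec.span_finite)
  let ?N = "\<Sum>i\<le>D. mscale (c (e i)) (E i)"
  have eq: "M *v axis x 1 = ?N *v axis x 1" by (simp add: c comb sum.reindex[OF inj])
  have "dist_invariant (M - ?N)"
    by (intro dist_invariant_diff M E_comb_invariant)
  moreover have "(M - ?N) *v axis x 1 = 0" using eq by (simp add: matrix_vector_mult_diff_rdistrib)
  ultimately have "M - ?N = 0" by (rule dist_invariant_eq_0)
  then show ?thesis by (intro that[of "\<lambda>i. c (e i)"]) simp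
qed

lemma E_sum: "(\<Sum>i\<le>D. E i) = mat 1"
proof -
  have "dist_invariant (mat 1)"
    unfolding dist_invariant_def
  proof (intro allI impI)
    fix u v u' v' assume "\<delta> u v = \<delta> u' v'"
    then have "u = v \<longleftrightarrow> u' = v'" using dist_eq_0_iff by metis
    then show "(mat 1 :: complex^'a^'a) $ u $ v = mat 1 $ u' $ v'" by (simp add: mat_def)
  qed
  then obtain c where c: "mat 1 = (\<Sum>i\<le>D. mscale (c i) (E i))" by (rule E_spans)
  \<comment> \<open>Multiplying the expansion of the identity by \<open>E i\<close> isolates its
    coefficient.\<close>
  have "mscale (c i) (E i) = E i" if "i \<le> D" for i
    using E_comb_mult[OF that, of c] by (simp flip: c)
  then show ?thesis using c by simp
qed

text \<open>Conjugate transposition is an involution of the commutative Bose-Mesner algebra that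
  respects products, so it permutes the minimal idempotents.\<close>

lemma conj_transpose_primitive:
  assumes P: "primitive_idempotent adj P"
  shows "primitive_idempotent adj (conj_transpose P)"
proof -
  have inv: "dist_invariant P" and idem: "P ** P = P" and nz: "P \<noteq> 0"
    using P by (auto simp: primitive_idempotent_def bose_mesner_iff)
  have "M = 0 \<or> M = conj_transpose P" if M: "dist_invariant M" "M ** M = M" "M ** conj_transpose P = M" for M
  proof -
    have "conj_transpose M ** P = conj_transpose (conj_transpose P ** M)" by (simp add: conj_transpose_mult)
    also have "\<dots> = conj_transpose M"
      using dist_invariant_mult_commute[OF M(1) dist_invariant_conj_transpose[OF inv]] M(3) by simp
    finally have "conj_transpose M = 0 \<or> conj_transpose M = P"
      using M conj_transpose_mult[of M M] by (intro primitive_minimal[OF P] dist_invariant_conj_transpose) simp_all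
    then show ?thesis by (metis conj_transpose_conj_transpose conj_transpose_0_iff)
  qed
  then show ?thesis
    using inv idem nz conj_transpose_mult[of P P]
    by (auto simp: primitive_idempotent_def bose_mesner_iff dist_invariant_conj_transpose)
qed

text \<open>The conjugate transpose of \<open>E i\<close> is some \<open>E j\<close>. If
  \<open>j \<noteq> i\<close>, orthogonality gives \<open>conj_transpose (E i) ** E i = 0\<close>,
  which forces \<open>E i = 0\<close>.\<close>

lemma E_hermitian:
  assumes i: "i \<le> D"
  shows "conj_transpose (E i) = E i"
proof -
  have "conj_transpose (E i) \<in> E ` {0..D}"
    using conj_transpose_primitive[OF E_primitive[OF i]] bij_betw_imp_surj_on[OF E_bij] by simp
  then obtain j where j: "j \<le> D" "conj_transpose (E i) = E j" by auto
  have "i = j"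
  proof (rule ccontr)
    assume "i \<noteq> j"
    then have "conj_transpose (E i) ** E i = 0" using E_orthogonal[OF j(1) i] j(2) by simp
    then show False using conj_transpose_mult_self_eq_0 E_nonzero[OF i] by blast
  qed
  then show ?thesis using j by simp
qed

lemma E_real:
  assumes i: "i \<le> D"
  shows "cnj (E i $ u $ v) = E i $ u $ v"
proof -
  have "cnj (E i $ u $ v) = conj_transpose (E i) $ v $ u" by (simp add: conj_transpose_def)
  then show ?thesis using E_hermitian[OF i] dist_invariant_sym[OF E_dist_invariant[OF i]] by simp
qed

section \<open>Krein parameters and the dual adjacency matrix\<close>

lemma Krein_parameters:
  obtains q :: "nat \<Rightarrow> nat \<Rightarrow> nat \<Rightarrow> complex" where
    "\<And>i j u v. i \<le> D \<Longrightarrow> j \<le> D \<Longrightarrow>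
       E i $ u $ v * E j $ u $ v = (1 / of_nat CARD('a)) * (\<Sum>h\<le>D. q h i j * E h $ u $ v)"
    "\<And>h i j. h \<le> D \<Longrightarrow> i \<le> D \<Longrightarrow> j \<le> D \<Longrightarrow> h > i + j \<or> i > h + j \<or> j > h + i \<Longrightarrow> q h i j = 0"
    "\<And>h i j. h \<le> D \<Longrightarrow> i \<le> D \<Longrightarrow> j \<le> D \<Longrightarrow> h = i + j \<or> i = h + j \<or> j = h + i \<Longrightarrow> q h i j \<noteq> 0"
proof -
  obtain q where q:
    "\<forall>i\<le>D. \<forall>j\<le>D. hadamard (E i) (E j) = mscale (1 / of_nat CARD('a)) (\<Sum>h\<le>D. mscale (q h i j) (E h))"
    "\<forall>h\<le>D. \<forall>i\<le>D. \<forall>j\<le>D. (h > i + j \<or> i > h + j \<or> j > h + i) \<longrightarrow> q h i j = 0"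
    "\<forall>h\<le>D. \<forall>i\<le>D. \<forall>j\<le>D. (h = i + j \<or> i = h + j \<or> j = h + i) \<longrightarrow> q h i j \<noteq> 0"
    using Q_polynomial unfolding Q_polynomial_def by blast
  show ?thesis
  proof (rule that[of q])
    fix i j u v assume "i \<le> D" "j \<le> D"
    then have "hadamard (E i) (E j) $ u $ v =
        mscale (1 / of_nat CARD('a)) (\<Sum>h\<le>D. mscale (q h i j) (E h)) $ u $ v"
      using q(1) by simp
    then show "E i $ u $ v * E j $ u $ v = (1 / of_nat CARD('a)) * (\<Sum>h\<le>D. q h i j * E h $ u $ v)"
      by simp
  qed (use q(2,3) in blast)+
qed

text \<open>
  Expand the all-ones matrix, the identity for the entrywise product, as \<open>J = \<Sum> b\<^sub>i E\<^sub>i\<close>. Since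
  \<open>E\<^sub>0 \<circ> E\<^sub>i\<close> is a nonzero multiple of \<open>E\<^sub>i\<close>, comparing coefficients in \<open>E\<^sub>0 = E\<^sub>0 \<circ> J\<close> leaves \<open>J = b\<^sub>0 E\<^sub>0\<close>.
\<close>
lemma E0_constant:
  obtains c where "\<And>u v. E 0 $ u $ v = c"
proof -
  obtain q where q:
    "\<And>i j u v. i \<le> D \<Longrightarrow> j \<le> D \<Longrightarrow>
       E i $ u $ v * E j $ u $ v = (1 / of_nat CARD('a)) * (\<Sum>h\<le>D. q h i j * E h $ u $ v)"
    "\<And>h i j. h \<le> D \<Longrightarrow> i \<le> D \<Longrightarrow> j \<le> D \<Longrightarrow> h > i + j \<or> i > h + j \<or> j > h + i \<Longrightarrow> q h i j = 0"
    "\<And>h i j. h \<le> D \<Longrightarrow> i \<le> D \<Longrightarrow> j \<le> D \<Longrightarrow> h = i + j \<or> i = h + j \<or> j = h + i \<Longrightarrow> q h i j \<noteq> 0"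
    by (rule Krein_parameters) blast
  define n where "n = (of_nat CARD('a) :: complex)"
  have n: "n \<noteq> 0" by (simp add: n_def)
  define J :: "complex^'a^'a" where "J = (\<chi> u v. 1)"
  have "dist_invariant J" by (simp add: dist_invariant_def J_def)
  then obtain b where b: "J = (\<Sum>i\<le>D. mscale (b i) (E i))" by (rule E_spans)
  have E0: "E 0 $ u $ v * E j $ u $ v = (q j 0 j / n) * E j $ u $ v" if "j \<le> D" for j u v
  proof -
    have "(\<Sum>h\<le>D. q h 0 j * E h $ u $ v) = (\<Sum>h\<in>{j}. q h 0 j * E h $ u $ v)"
    proof (rule sum.mono_neutral_right)
      show "\<forall>h\<in>{..D} - {j}. q h 0 j * E h $ u $ v = 0"
      proof
        fix h assume "h \<in> {..D} - {j}"
        then have "q h 0 j = 0" using that by (intro q(2)) auto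
        then show "q h 0 j * E h $ u $ v = 0" by simp
      qed
    qed (use that in auto)
    then show ?thesis using q(1)[of 0 j u v] that by (simp add: n_def)
  qed
  define c where "c i = b i * (q i 0 i / n) - (if i = 0 then 1 else 0)" for i
  have "(\<Sum>i\<le>D. mscale (c i) (E i)) $ u $ v = 0" for u v
  proof -
    have J1: "(\<Sum>i\<le>D. b i * E i $ u $ v) = 1"
      using arg_cong[OF b, of "\<lambda>M. M $ u $ v"] by (simp add: J_def)
    have "(\<Sum>i\<le>D. mscale (c i) (E i)) $ u $ v
      = (\<Sum>i\<le>D. b i * ((q i 0 i / n) * E i $ u $ v)) - (\<Sum>i\<le>D. if i = 0 then E 0 $ u $ v else 0)"
      unfolding sum_component mscale_component sum_subtractf[symmetric]
      by (intro sum.cong) (auto simp: c_def algebra_simps)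
    also have "(\<Sum>i\<le>D. b i * ((q i 0 i / n) * E i $ u $ v)) = (\<Sum>i\<le>D. E 0 $ u $ v * (b i * E i $ u $ v))"
    proof (intro sum.cong refl)
      fix i assume "i \<in> {..D}"
      then have "i \<le> D" by simp
      from E0[OF this, of u v] show "b i * ((q i 0 i / n) * E i $ u $ v) = E 0 $ u $ v * (b i * E i $ u $ v)"
        by (metis mult.left_commute)
    qed
    also have "\<dots> = E 0 $ u $ v" by (simp add: sum_distrib_left[symmetric] J1)
    finally show ?thesis by simp
  qed
  then have c0: "c i = 0" if "i \<le> D" for i
    using that by (intro E_comb_eq_0) (simp_all add: vec_eq_iff)
  have b0: "b i = 0" if "i \<le> D" "i \<noteq> 0" for i
  proof -
    have "q i 0 i \<noteq> 0" using that by (intro q(3)) auto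
    then show ?thesis using c0[of i] that n by (simp add: c_def)
  qed
  have "J = (\<Sum>i\<in>{0}. mscale (b i) (E i))"
    unfolding b by (rule sum.mono_neutral_right) (use b0 in \<open>auto simp: vec_eq_iff\<close>)
  then have "b 0 * E 0 $ u $ v = 1" for u v
    by (simp add: J_def vec_eq_iff)
  then have "E 0 $ u $ v = 1 / b 0" for u v
    by (metis mult_zero_left nonzero_mult_div_cancel_left zero_neq_one)
  then show ?thesis by (rule that)
qed

text \<open>Dual to \<open>distmat_in_gen_alg\<close>: diagonal matrices multiply entrywise, and the
  entrywise product of \<open>E 1\<close> and \<open>E (j - 1)\<close> is a combination of the
  \<open>E h\<close> with \<open>h \<le> j\<close> whose coefficient at \<open>j\<close> is nonzero.
  The case \<open>j = 0\<close> needs \<open>E 0\<close> to be constant.\<close>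

lemma diag_E_in_gen_alg:
  assumes "j \<le> D"
  shows "diag_matrix (\<lambda>y. E j $ x $ y) \<in> gen_alg P (Astar E x)"
  using assms
proof (induction j rule: less_induct)
  case (less j)
  obtain q where q:
    "\<And>i j u v. i \<le> D \<Longrightarrow> j \<le> D \<Longrightarrow>
       E i $ u $ v * E j $ u $ v = (1 / of_nat CARD('a)) * (\<Sum>h\<le>D. q h i j * E h $ u $ v)"
    "\<And>h i j. h \<le> D \<Longrightarrow> i \<le> D \<Longrightarrow> j \<le> D \<Longrightarrow> h > i + j \<or> i > h + j \<or> j > h + i \<Longrightarrow> q h i j = 0"
    "\<And>h i j. h \<le> D \<Longrightarrow> i \<le> D \<Longrightarrow> j \<le> D \<Longrightarrow> h = i + j \<or> i = h + j \<or> j = h + i \<Longrightarrow> q h i j \<noteq> 0"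
    by (rule Krein_parameters) blast
  define n where "n = (of_nat CARD('a) :: complex)"
  have n: "n \<noteq> 0" by (simp add: n_def)
  have E1: "diag_matrix (\<lambda>y. E 1 $ x $ y) \<in> gen_alg P (Astar E x)"
  proof -
    have "diag_matrix (\<lambda>y. E 1 $ x $ y) = mscale (1 / n) (Astar E x)"
      unfolding Astar_diag by (simp add: vec_eq_iff diag_matrix_component n_def)
    then show ?thesis by (simp add: gen_alg.scale gen_alg.gen2)
  qed
  consider "j = 0" | "j = 1" | k where "j = Suc k" "1 \<le> k" by (cases j rule: nat.exhaust; cases "j - 1") auto
  then show ?case
  proof cases
    case 1
    obtain c where "\<And>u v. E 0 $ u $ v = c" by (rule E0_constant) blast
    then have "diag_matrix (\<lambda>y. E j $ x $ y) = mscale c (mat 1)"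
      using 1 by (simp add: vec_eq_iff diag_matrix_component mat_def)
    then show ?thesis by (simp add: gen_alg.scale gen_alg.one)
  next
    case 2
    then show ?thesis using E1 by simp
  next
    case (3 k)
    let ?g = "\<lambda>h. diag_matrix (\<lambda>y. E h $ x $ y)"
    let ?R = "mscale n (?g 1 ** ?g k) - (\<Sum>h<j. mscale (q h 1 k) (?g h))"
    have k: "k \<le> D" "1 \<le> D" using 3 less.prems by auto
    have qj: "q j 1 k \<noteq> 0" using less.prems k 3 by (intro q(3)) auto
    have eq: "n * (E 1 $ x $ y * E k $ x $ y) = (\<Sum>h<j. q h 1 k * E h $ x $ y) + q j 1 k * E j $ x $ y" for y
    proof -
      have "n * (E 1 $ x $ y * E k $ x $ y) = (\<Sum>h\<le>D. q h 1 k * E h $ x $ y)"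
        using q(1)[OF k(2,1), of x y] n by (simp add: n_def)
      also have "\<dots> = (\<Sum>h\<le>j. q h 1 k * E h $ x $ y)"
      proof (rule sum.mono_neutral_right)
        show "\<forall>h\<in>{..D} - {..j}. q h 1 k * E h $ x $ y = 0"
        proof
          fix h assume "h \<in> {..D} - {..j}"
          then have "q h 1 k = 0" using k 3 by (intro q(2)) auto
          then show "q h 1 k * E h $ x $ y = 0" by simp
        qed
      qed (use less.prems in auto)
      also have "\<dots> = (\<Sum>h<j. q h 1 k * E h $ x $ y) + q j 1 k * E j $ x $ y"
        by (simp add: lessThan_Suc_atMost[symmetric])
      finally show ?thesis .
    qed
    have "?R $ y $ z = q j 1 k * ?g j $ y $ z" for y z
      using eq[of y] by (cases "y = z") (simp_all add: diag_matrix_mult_diag diag_matrix_component)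
    then have "?g j = mscale (1 / q j 1 k) ?R"
      using qj by (simp add: vec_eq_iff)
    moreover have "?R \<in> gen_alg P (Astar E x)"
      by (intro gen_alg_diff gen_alg_sum gen_alg.scale gen_alg.mult E1 less.IH)
        (use 3 less.prems in auto)
    ultimately show ?thesis by (simp add: gen_alg.scale)
  qed
qed

text \<open>The diagonal of \<open>Estar adj x i\<close> is row \<open>x\<close> of
  \<open>distmat adj i\<close>, which expands in the rows of the \<open>E j\<close>.\<close>

lemma Estar_in_gen_alg: "Estar adj x i \<in> gen_alg P (Astar E x)"
proof -
  obtain c where c: "distmat adj i = (\<Sum>j\<le>D. mscale (c j) (E j))"
    using E_spans[OF dist_invariant_distmat] .
  have "(if \<delta> x y = i then 1 else 0) = (\<Sum>j\<le>D. c j * E j $ x $ y)" for y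
    using arg_cong[OF c, of "\<lambda>M. M $ x $ y"] by (simp add: distmat_def)
  then have "Estar adj x i = (\<Sum>j\<le>D. mscale (c j) (diag_matrix (\<lambda>y. E j $ x $ y)))"
    unfolding Estar_diag by (auto simp: vec_eq_iff diag_matrix_component)
  also have "\<dots> \<in> gen_alg P (Astar E x)"
    by (intro gen_alg_sum gen_alg.scale diag_E_in_gen_alg) simp
  finally show ?thesis .
qed

text \<open>
  The squared Frobenius norm of \<open>E\<^sub>i A\<^sup>* E\<^sub>k\<close> is a multiple of the \<open>(x, x)\<close> entry of
  \<open>E\<^sub>1 (E\<^sub>i \<circ> E\<^sub>k) E\<^sub>1\<close>, which is a multiple of the Krein parameter \<open>q 1 i k\<close>.
\<close>
lemma E_Astar_E:
  assumes i: "i \<le> D" and k: "k \<le> D" and ik: "Suc i < k \<or> Suc k < i"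
  shows "E i ** Astar E x ** E k = 0"
proof -
  obtain q where q:
    "\<And>i j u v. i \<le> D \<Longrightarrow> j \<le> D \<Longrightarrow>
       E i $ u $ v * E j $ u $ v = (1 / of_nat CARD('a)) * (\<Sum>h\<le>D. q h i j * E h $ u $ v)"
    "\<And>h i j. h \<le> D \<Longrightarrow> i \<le> D \<Longrightarrow> j \<le> D \<Longrightarrow> h > i + j \<or> i > h + j \<or> j > h + i \<Longrightarrow> q h i j = 0"
    by (rule Krein_parameters) blast
  define n where "n = (of_nat CARD('a) :: complex)"
  have D1: "1 \<le> D" using D_pos by simp
  define a where "a y = n * E 1 $ x $ y" for y
  have As: "Astar E x = diag_matrix a" unfolding Astar_diag a_def n_def ..
  have areal: "cnj (a y) = a y" for y unfolding a_def n_def complex_cnj_mult E_real[OF D1] by simp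
  define M where "M = E i ** diag_matrix a ** E k"
  have Mreal: "conj_transpose M = E k ** diag_matrix a ** E i"
  proof -
    have "conj_transpose (diag_matrix a) = diag_matrix a" by (auto simp: conj_transpose_def vec_eq_iff diag_matrix_component areal)
    then show ?thesis by (simp add: M_def conj_transpose_mult E_hermitian i k matrix_mul_assoc)
  qed
  define H where "H = hadamard (E i) (E k)"
  have "trace (M ** conj_transpose M) = trace (E i ** (diag_matrix a ** E k ** diag_matrix a ** E i))"
  proof -
    have "E k ** (E k ** N) = E k ** N" for N :: "complex^'a^'a" by (simp add: matrix_mul_assoc E_idem[OF k])
    then show ?thesis unfolding Mreal unfolding M_def by (simp add: matrix_mul_assoc[symmetric])
  qed
  also have "\<dots> = trace ((diag_matrix a ** E k ** diag_matrix a) ** E i)"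
    by (subst trace_mul_sym) (simp add: matrix_mul_assoc[symmetric] E_idem[OF i])
  also have "\<dots> = (\<Sum>y\<in>UNIV. \<Sum>z\<in>UNIV. a y * E k $ y $ z * a z * E i $ z $ y)"
  proof -
    have "diag_matrix a ** E k ** diag_matrix a = (\<chi> y z. a y * E k $ y $ z * a z)"
      by (simp add: diag_matrix_mult mult_diag_matrix)
    then show ?thesis by (simp add: trace_def matrix_matrix_mult_def)
  qed
  also have "\<dots> = (\<Sum>y\<in>UNIV. \<Sum>z\<in>UNIV. n^2 * (E 1 $ x $ y * H $ y $ z * E 1 $ z $ x))"
  proof (intro sum.cong refl)
    fix y z
    have sym: "E 1 $ z $ x = E 1 $ x $ z" "E i $ z $ y = E i $ y $ z"
      by (rule dist_invariant_sym, rule E_dist_invariant, fact)+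
    show "a y * E k $ y $ z * a z * E i $ z $ y = n^2 * (E 1 $ x $ y * H $ y $ z * E 1 $ z $ x)"
      unfolding a_def H_def hadamard_component sym by (simp add: power2_eq_square mult_ac)
  qed
  also have "\<dots> = n^2 * (E 1 ** (H ** E 1)) $ x $ x"
    by (simp add: matrix_matrix_mult_def sum_distrib_left mult.assoc)
  also have "H = mscale (1 / n) (\<Sum>h\<le>D. mscale (q h i k) (E h))"
    using q(1)[OF i k] by (simp add: H_def vec_eq_iff n_def)
  \<comment> \<open>Multiplication by \<open>E 1\<close> leaves only the term
    \<open>h = 1\<close>.\<close>
  also have "\<dots> ** E 1 = mscale (1 / n) (mscale (q 1 i k) (E 1))"
    by (simp only: mscale_mult_left E_comb_mult[OF D1])
  also have "q 1 i k = 0" using ik by (intro q(2) D1 i k) auto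
  finally have tr: "trace (M ** conj_transpose M) = 0"
    by (simp add: mscale_mult_right)
  have "trace (M ** conj_transpose M) = (\<Sum>u\<in>UNIV. \<Sum>v\<in>UNIV. M $ u $ v * cnj (M $ u $ v))"
    by (simp add: trace_def matrix_matrix_mult_def conj_transpose_def)
  also have "\<dots> = of_real (\<Sum>u\<in>UNIV. \<Sum>v\<in>UNIV. (cmod (M $ u $ v))^2)"
    by (simp add: complex_norm_square[symmetric])
  finally have "(\<Sum>u\<in>UNIV. \<Sum>v\<in>UNIV. (cmod (M $ u $ v))^2) = 0"
    using tr by (metis of_real_eq_0_iff)
  then have "M = 0"
    by (simp add: sum_nonneg_eq_0_iff sum_nonneg vec_eq_iff)
  then show ?thesis by (simp add: M_def As)
qed

lemma dual_idempotent_systems: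
  obtains \<theta> \<phi> where "dual_idempotent_systems (distmat adj 1) (Astar E x) E (Estar adj x) \<theta> \<phi> D"
proof -
  obtain \<theta> where \<theta>: "distmat adj 1 = (\<Sum>i\<le>D. mscale (\<theta> i) (E i))"
    using E_spans[OF dist_invariant_distmat] .
  have D1: "1 \<le> D" using D_pos by simp
  \<comment> \<open>The entry of \<open>E 1\<close> depends only on the distance, so any vertex at
    distance \<open>i\<close> gives the dual eigenvalue.\<close>
  define \<phi> where "\<phi> i = of_nat CARD('a) * E 1 $ x $ (SOME y. \<delta> x y = i)" for i
  have \<phi>: "of_nat CARD('a) * E 1 $ x $ y = \<phi> (\<delta> x y)" for y
  proof -
    have "\<delta> x (SOME z. \<delta> x z = \<delta> x y) = \<delta> x y" by (rule someI) (rule refl)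
    from dist_invariantD[OF E_dist_invariant[OF D1] this] show ?thesis by (simp add: \<phi>_def)
  qed
  have "dual_idempotent_systems (distmat adj 1) (Astar E x) E (Estar adj x) \<theta> \<phi> D"
  proof
    fix i j v assume i: "i \<le> D" and j: "j \<le> D"
    show "E i *v (E j *v v) = (if i = j then E i *v v else 0)"
      using i j E_orthogonal E_idem by (simp add: matrix_vector_mul_assoc)
    show "Estar adj x i *v (Estar adj x j *v v) = (if i = j then Estar adj x i *v v else 0)"
      by (simp add: vec_eq_iff Estar_diag)
    assume ij: "Suc i < j \<or> Suc j < i"
    show "Estar adj x i *v (distmat adj 1 *v (Estar adj x j *v v)) = 0"
      by (simp only: matrix_vector_mul_assoc matrix_mul_assoc Estar_distmat_Estar[OF ij] matrix_vector_mult_0)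
    show "E i *v (Astar E x *v (E j *v v)) = 0"
      by (simp only: matrix_vector_mul_assoc matrix_mul_assoc E_Astar_E[OF i j ij] matrix_vector_mult_0)
  next
    fix v
    show "(\<Sum>i\<le>D. E i *v v) = v"
      by (simp add: sum_matrix_vec_mult[symmetric] E_sum)
    show "(\<Sum>i\<le>D. Estar adj x i *v v) = v"
      by (simp add: vec_eq_iff Estar_diag if_distrib if_distribR dist_le_D cong: if_cong)
  next
    fix i v assume i: "i \<le> D"
    have "E i ** distmat adj 1 = distmat adj 1 ** E i"
      by (intro dist_invariant_mult_commute E_dist_invariant i dist_invariant_distmat)
    also have "\<dots> = mscale (\<theta> i) (E i)" unfolding \<theta> by (rule E_comb_mult[OF i])
    finally show "E i *v (distmat adj 1 *v v) = \<theta> i *s (E i *v v)"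
      unfolding matrix_vector_mul_assoc by (simp only: mscale_mult_vec)
    show "Estar adj x i *v (Astar E x *v v) = \<phi> i *s (Estar adj x i *v v)"
      unfolding Estar_diag Astar_diag \<phi> by (simp add: vec_eq_iff)
  next
    fix i u v assume i: "i \<le> D"
    show "cinner (E i *v u) v = cinner u (E i *v v)"
      using cinner_conj_transpose[of "E i" u v] E_hermitian[OF i] by simp
    have "conj_transpose (Estar adj x i) = Estar adj x i"
      by (auto simp: Estar_diag conj_transpose_def vec_eq_iff diag_matrix_component)
    then show "cinner (Estar adj x i *v u) v = cinner u (Estar adj x i *v v)"
      using cinner_conj_transpose[of "Estar adj x i" u v] by simp
  next
    fix u v
    have "conj_transpose (distmat adj 1) = distmat adj 1"
      by (auto simp: conj_transpose_def distmat_def vec_eq_iff dist_commute)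
    then show "cinner (distmat adj 1 *v u) v = cinner u (distmat adj 1 *v v)"
      using cinner_conj_transpose[of "distmat adj 1" u v] by simp
    have "conj_transpose (Astar E x) = Astar E x"
      using E_real[OF D1] unfolding Astar_diag by (auto simp: conj_transpose_def vec_eq_iff diag_matrix_component)
    then show "cinner (Astar E x *v u) v = cinner u (Astar E x *v v)"
      using cinner_conj_transpose[of "Astar E x" u v] by simp
  next
    fix i v and W :: "(complex^'a) set"
    assume i: "i \<le> D" and W: "vec.subspace W" "\<And>v. v \<in> W \<Longrightarrow> distmat adj 1 *v v \<in> W"
      "\<And>v. v \<in> W \<Longrightarrow> Astar E x *v v \<in> W" and v: "v \<in> W"
    have inv: "M *v v \<in> W" if "M \<in> gen_alg (distmat adj 1) (Astar E x)" for M
      using gen_alg_invariant_iff[OF W(1), of "distmat adj 1" "Astar E x"] W(2,3) v that by blast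
    show "E i *v v \<in> W" by (intro inv dist_invariant_in_gen_alg E_dist_invariant i)
    show "Estar adj x i *v v \<in> W" by (intro inv Estar_in_gen_alg)
  qed
  then show ?thesis by (rule that)
qed

text \<open>Each graph notion is identified with its counterpart for the two idempotent systems,
  where \<open>flag_Int_height\<close> applies with \<open>k = D + \<eta>\<close>.\<close>

theorem Vij_Int_Veta:
  assumes i: "i \<le> D" and j: "j \<le> D"
  shows "Vij adj E x (int i) (int j) \<inter> Veta adj E x \<eta> =
         cspan (\<Union> {Vtilde adj E x r s | r s. r \<le> i \<and> s \<le> j \<and> r + s = D + \<eta>})"
proof -
  obtain \<theta> \<phi> where "dual_idempotent_systems (distmat adj 1) (Astar E x) E (Estar adj x) \<theta> \<phi> D"
    by (rule dual_idempotent_systems)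
  then interpret S: dual_idempotent_systems "distmat adj 1" "Astar E x" E "Estar adj x" \<theta> \<phi> D .
  have Vij: "Vij adj E x (int r) (int s) = S.flag r s" if "r \<le> D" "s \<le> D" for r s
    using S.span_components_Int[OF that] by (simp add: Vij_def cspan_eq)
  \<comment> \<open>At index \<open>-1\<close> the space is \<open>{0}\<close> by convention,
    whereas \<open>flag\<close> has natural indices and needs the case split.\<close>
  have Vij_pred: "Vij adj E x (int r) (int s - 1) = (if s = 0 then {0} else S.flag r (s - 1))"
    "Vij adj E x (int r - 1) (int s) = (if r = 0 then {0} else S.flag (r - 1) s)"
    if "r \<le> D" "s \<le> D" for r s
    using Vij[of r "s - 1"] Vij[of "r - 1" s] that by (auto simp: Vij_def[of _ _ _ _ "-1"] Vij_def[of _ _ _ "-1"])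
  have Vtilde: "Vtilde adj E x r s = S.flag_top r s" if rs: "r \<le> D" "s \<le> D" for r s
  proof -
    let ?U = "Vij adj E x (int r) (int s - 1)" and ?U' = "Vij adj E x (int r - 1) (int s)"
    have "0 \<in> ?U" "0 \<in> ?U'"
      unfolding Vij_pred[OF rs] using S.subspace_flag by (auto simp: vec.subspace_0)
    then have "(\<forall>u\<in>setsum ?U ?U'. cinner u v = 0) \<longleftrightarrow> v \<in> perp ?U \<and> v \<in> perp ?U'" for v
      by (rule perp_setsum_iff)
    then show ?thesis
      unfolding Vtilde_def S.flag_top_def Vij[OF rs] Vij_pred[OF rs] by (auto simp: perp_def)
  qed
  have module: "T_module adj E x W \<longleftrightarrow> S.submodule W" for W
    unfolding T_module_def S.submodule_def csubspace_eq Talg_def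
    using gen_alg_invariant_iff[of W "distmat adj 1" "Astar E x"] by blast
  have irred: "irreducible_T_module adj E x W \<longleftrightarrow> S.simple W" for W
    unfolding irreducible_T_module_def S.simple_def module ..
  have displ: "displacement adj E x W = int (S.height W) - int D" for W
    by (simp add: displacement_def S.height_def endpoint_def dual_endpoint_def module_diameter_def)
  have "displacement adj E x W = int \<eta> \<longleftrightarrow> S.height W = D + \<eta>" for W
    unfolding displ by linarith
  then have Veta: "Veta adj E x \<eta> = vec.span (\<Union> {W. S.simple W \<and> S.height W = D + \<eta>})"
    by (simp only: Veta_def cspan_eq irred)
  have "{Vtilde adj E x r s | r s. r \<le> i \<and> s \<le> j \<and> r + s = D + \<eta>} =
      {S.flag_top r s | r s. r \<le> i \<and> s \<le> j \<and> r + s = D + \<eta>}"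
  proof -
    have "Vtilde adj E x r s = S.flag_top r s" if "r \<le> i \<and> s \<le> j \<and> r + s = D + \<eta>" for r s
      using that i j by (intro Vtilde) auto
    then show ?thesis by (metis (no_types, lifting))
  qed
  then show ?thesis
    unfolding Veta Vij[OF i j] cspan_eq by (simp only: S.flag_Int_height)
qed

end

text \<open>The condition \<open>r + s - D = \<eta>\<close> is written additively, which avoids
  truncated subtraction on naturals.\<close>

theorem mainTheorem8:
  fixes adj :: "'a::finite \<Rightarrow> 'a \<Rightarrow> bool"
    and E :: "nat \<Rightarrow> complex^'a^'a"
    and x :: 'a
    and i j \<eta> :: nat
  assumes "distance_regular adj"
    and "diam adj \<ge> 3"
    and "Q_polynomial adj E"
    and "i \<le> diam adj" and "j \<le> diam adj" and "i + j \<ge> diam adj"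
    and "\<eta> \<le> diam adj"
  shows "Vij adj E x (int i) (int j) \<inter> Veta adj E x \<eta> =
         cspan (\<Union> {Vtilde adj E x r s | r s. r \<le> i \<and> s \<le> j \<and> r + s = diam adj + \<eta>})"
proof -
  interpret Q_polynomial_graph adj E x
    using assms by unfold_locales auto
  show ?thesis using assms by (intro Vij_Int_Veta)
qed

end
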